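(* Let $(X,J,g)$ be a compact Hermitian manifold and let $\rho=\sqrt{-1}\rho_{i\bar j}\,dz^i\wedge d\bar z^j$ be a real closed $(1,1)$-form on $X$ such that $g^{i\bar j}\rho_{i\bar j}$ is constant. Then $$g^{i\bar j}\partial_i\partial_{\bar j}|\rho|^2=2|\nabla^+\rho|^2+2Q_{i\bar jk\bar l}\left(g^{i\bar j}(\rho^2)^{k\bar l}-\rho^{i\bar j}\rho^{k\bar l}\right),$$ where $\nabla^+$ is the Bismut connection and $Q_{i\bar jk\bar l}=R_{i\bar jk\bar l}-g^{p\bar q}T_{kp\bar j}\overline{T_{lq\bar i}}$, with $R$ and $T$ the curvature and torsion of the Chern connection.
   Context: In local holomorphic coordinates $\omega=\sum g_{i\bar j}\sqrt{-1}\,dz^i\wedge d\bar z^j$; repeated indices are summed and $g^{i\bar j}$ is the inverse matrix. Chern connection coefficients: $\Gamma_{ki}^j=g^{j\bar m}\partial_kg_{i\bar m}$, with $\nabla_iX^j=\partial_iX^j+\Gamma_{il}^jX^l$, $\nabla_{\bar i}X^j=\partial_{\bar i}X^j$. Torsion: $T_{ij}^k=\Gamma_{ij}^k-\Gamma_{ji}^k$, $T_{ij\bar k}=g_{m\bar k}T_{ij}^m=\partial_ig_{j\bar k}-\partial_jg_{i\bar k}$. Curvature: $R_{i\bar jk}{}^{l}=-\partial_{\bar j}\Gamma_{ik}^l$, $R_{i\bar jk\bar l}=g_{m\bar l}R_{i\bar jk}{}^{m}$. Bismut connection $\nabla^+$ on $T^{1,0}X$: $\nabla^+_iX^j=\partial_iX^j+\Gamma_{li}^jX^l$,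 $\nabla^+_{\bar i}X^j=\partial_{\bar i}X^j+g^{j\bar m}\overline{T_{im\bar l}}X^l$, extended to $(1,1)$-forms in the standard way, so that $\nabla^+_i\rho_{k\bar m}=\partial_i\rho_{k\bar m}-\Gamma_{ki}^l\rho_{l\bar m}-g^{q\bar p}T_{iq\bar m}\rho_{k\bar p}$. Real means $\overline{\rho_{k\bar j}}=\rho_{j\bar k}$. Conventions: $|\rho|^2=g^{p\bar q}g^{k\bar l}\rho_{k\bar q}\rho_{p\bar l}$; $|\nabla^+\rho|^2$ denotes the squared norm of the $(1,0)$-derivative, i.e. $|\nabla^+\rho|^2=\sum_{i,k,m}|\nabla^+_i\rho_{k\bar m}|^2$ in coordinates with $g_{i\bar j}=\delta_{ij}$ at the point; $(\rho^2)_{k\bar l}=g^{p\bar q}\rho_{k\bar q}\rho_{p\bar l}$. Indices are raised with $g$; thus at a point where $g_{i\bar j}=\delta_{ij}$ and $\rho_{i\bar j}=\lambda_i\delta_{ij}$, the last term equals $2\sum_{k,m}Q_{m\bar mk\bar k}(\lambda_k^2-\lambda_k\lambda_m)$. *)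

theory Defs
  imports "HOL-Analysis.Analysis"
begin

section \<open>Calculus on open subsets of complex n-space\<close>

text \<open>\<open>Ck_on k S f\<close>: on an open set \<open>S\<close>, \<open>f\<close> is \<open>k\<close> times continuously
  differentiable in the real sense.\<close>

primrec Ck_on ::
  "nat \<Rightarrow> 'b::real_normed_vector set \<Rightarrow> ('b \<Rightarrow> 'c::real_normed_vector) \<Rightarrow> bool" where
  "Ck_on 0 S f \<longleftrightarrow> continuous_on S f"
| "Ck_on (Suc k) S f \<longleftrightarrow>
     (\<forall>x\<in>S. f differentiable (at x)) \<and> (\<forall>v. Ck_on k S (\<lambda>x. frechet_derivative f (at x) v))"

definition smooth_on :: "'b::real_normed_vector set \<Rightarrow> ('b \<Rightarrow> 'c::real_normed_vector) \<Rightarrow> bool" where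
  "smooth_on S f \<longleftrightarrow> (\<forall>k. Ck_on k S f)"

definition holomorphic_map_on :: "(complex^'n) set \<Rightarrow> (complex^'n \<Rightarrow> complex^'m) \<Rightarrow> bool" where
  "holomorphic_map_on S f \<longleftrightarrow>
     (\<forall>z\<in>S. \<exists>L. (f has_derivative L) (at z) \<and> (\<forall>c v. L (c *s v) = c *s L v))"

text \<open>The Wirtinger derivatives \<open>\<partial>\<^sub>i = (\<partial>/\<partial>x\<^sup>i - \<i> \<partial>/\<partial>y\<^sup>i)/2\<close> and
  \<open>\<partial>\<^bsub>i-bar\<^esub> = (\<partial>/\<partial>x\<^sup>i + \<i> \<partial>/\<partial>y\<^sup>i)/2\<close>, where \<open>z\<^sup>i = x\<^sup>i + \<i> y\<^sup>i\<close>.\<close>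

definition dz :: "'n \<Rightarrow> (complex^'n \<Rightarrow> complex) \<Rightarrow> complex^'n \<Rightarrow> complex" where
  "dz i f z = (frechet_derivative f (at z) (axis i 1)
               - \<i> * frechet_derivative f (at z) (axis i \<i>)) / 2"

definition dzbar :: "'n \<Rightarrow> (complex^'n \<Rightarrow> complex) \<Rightarrow> complex^'n \<Rightarrow> complex" where
  "dzbar i f z = (frechet_derivative f (at z) (axis i 1)
                  + \<i> * frechet_derivative f (at z) (axis i \<i>)) / 2"


section \<open>Complex manifolds and tensors of type (1,1)\<close>

type_synonym ('a, 'n) chart = "'a set \<times> ('a \<Rightarrow> complex^'n)"

definition coord_change :: "('a, 'n::finite) chart \<Rightarrow> ('a, 'n) chart \<Rightarrow> complex^'n \<Rightarrow> complex^'n" where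
  "coord_change C D = snd D \<circ> inv_into (fst C) (snd C)"

definition holomorphic_atlas :: "'a topology \<Rightarrow> ('a, 'n::finite) chart set \<Rightarrow> bool" where
  "holomorphic_atlas X A \<longleftrightarrow>
     (\<Union>C\<in>A. fst C) = topspace X \<and>
     (\<forall>C\<in>A. openin X (fst C) \<and> open (snd C ` fst C) \<and>
        homeomorphic_map (subtopology X (fst C)) (top_of_set (snd C ` fst C)) (snd C)) \<and>
     (\<forall>C\<in>A. \<forall>D\<in>A. holomorphic_map_on (snd C ` (fst C \<inter> fst D)) (coord_change C D))"

text \<open>Second countability need not be required: it follows from compactness.\<close>

definition compact_complex_manifold :: "'a topology \<Rightarrow> ('a, 'n::finite) chart set \<Rightarrow> bool" where
  "compact_complex_manifold X A \<longleftrightarrow>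
     compact_space X \<and> Hausdorff_space X \<and> holomorphic_atlas X A"

text \<open>A field of matrices on a coordinate domain; the entry \<open>h z $ i $ j\<close> stands for the
  component \<open>h\<^bsub>i j-bar\<^esub>\<close> at the point with coordinates \<open>z\<close>, so the second index is the
  barred one. A tensor on the manifold is given by its components in every chart.\<close>

type_synonym 'n matfield = "complex^'n \<Rightarrow> complex^'n^'n"
type_synonym ('a, 'n) tensor11 = "('a, 'n) chart \<Rightarrow> 'n matfield"

definition smooth_tensor11 :: "('a, 'n::finite) chart set \<Rightarrow> ('a, 'n) tensor11 \<Rightarrow> bool" where
  "smooth_tensor11 A h \<longleftrightarrow>
     (\<forall>C\<in>A. \<forall>i j. smooth_on (snd C ` fst C) (\<lambda>z. h C z $ i $ j)) \<and>
     (\<forall>C\<in>A. \<forall>D\<in>A. \<forall>p \<in> fst C \<inter> fst D. \<forall>i j.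
        h C (snd C p) $ i $ j =
          (\<Sum>a\<in>UNIV. \<Sum>b\<in>UNIV. h D (snd D p) $ a $ b
             * dz i (\<lambda>z. coord_change C D z $ a) (snd C p)
             * cnj (dz j (\<lambda>z. coord_change C D z $ b) (snd C p))))"

definition hermitian_mat :: "complex^'n^'n \<Rightarrow> bool" where
  "hermitian_mat M \<longleftrightarrow> (\<forall>i j. cnj (M $ i $ j) = M $ j $ i)"

text \<open>For a Hermitian matrix the form below takes only real values.\<close>

definition pos_def_mat :: "complex^'n^'n \<Rightarrow> bool" where
  "pos_def_mat M \<longleftrightarrow>
     (\<forall>v. v \<noteq> 0 \<longrightarrow> 0 < Re (\<Sum>i\<in>UNIV. \<Sum>j\<in>UNIV. M $ i $ j * v $ i * cnj (v $ j)))"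

definition hermitian_metric :: "('a, 'n::finite) chart set \<Rightarrow> ('a, 'n) tensor11 \<Rightarrow> bool" where
  "hermitian_metric A g \<longleftrightarrow>
     smooth_tensor11 A g \<and>
     (\<forall>C\<in>A. \<forall>z \<in> snd C ` fst C. hermitian_mat (g C z) \<and> pos_def_mat (g C z))"

definition compact_hermitian_manifold ::
  "'a topology \<Rightarrow> ('a, 'n::finite) chart set \<Rightarrow> ('a, 'n) tensor11 \<Rightarrow> bool" where
  "compact_hermitian_manifold X A g \<longleftrightarrow> compact_complex_manifold X A \<and> hermitian_metric A g"

definition real_form11 :: "('a, 'n::finite) chart set \<Rightarrow> ('a, 'n) tensor11 \<Rightarrow> bool" where
  "real_form11 A \<rho> \<longleftrightarrow>
     smooth_tensor11 A \<rho> \<and> (\<forall>C\<in>A. \<forall>z \<in> snd C ` fst C. hermitian_mat (\<rho> C z))"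

text \<open>The 2-form \<open>\<i> \<Sum> r\<^bsub>i j-bar\<^esub> dz\<^sup>i \<and> dz-bar\<^sup>j\<close>, evaluated at the real tangent
  vectors \<open>u\<close>, \<open>v\<close>; a real tangent vector of complex n-space is identified with an element of
  complex n-space.\<close>

definition form11 :: "'n::finite matfield \<Rightarrow> complex^'n \<Rightarrow> complex^'n \<Rightarrow> complex^'n \<Rightarrow> complex" where
  "form11 r z u v =
     \<i> * (\<Sum>i\<in>UNIV. \<Sum>j\<in>UNIV. r z $ i $ j * (u $ i * cnj (v $ j) - v $ i * cnj (u $ j)))"

text \<open>The exterior derivative of a 2-form, evaluated on constant vector fields (whose brackets
  vanish).\<close>

definition ext_deriv2 ::
  "(complex^'n \<Rightarrow> complex^'n \<Rightarrow> complex^'n \<Rightarrow> complex) \<Rightarrow>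
     complex^'n \<Rightarrow> complex^'n \<Rightarrow> complex^'n \<Rightarrow> complex^'n \<Rightarrow> complex" where
  "ext_deriv2 \<alpha> z u v w =
     frechet_derivative (\<lambda>x. \<alpha> x v w) (at z) u
     - frechet_derivative (\<lambda>x. \<alpha> x u w) (at z) v
     + frechet_derivative (\<lambda>x. \<alpha> x u v) (at z) w"

definition closed_form11 :: "('a, 'n::finite) chart set \<Rightarrow> ('a, 'n) tensor11 \<Rightarrow> bool" where
  "closed_form11 A \<rho> \<longleftrightarrow>
     (\<forall>C\<in>A. \<forall>z \<in> snd C ` fst C. \<forall>u v w. ext_deriv2 (form11 (\<rho> C)) z u v w = 0)"


section \<open>Hermitian geometry in a coordinate chart\<close>

text \<open>\<open>ginv g z i j\<close> is \<open>g\<^bsup>i j-bar\<^esup>\<close>, normalised by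
  \<open>\<Sum>\<^sub>j g\<^bsup>i j-bar\<^esup> g\<^bsub>k j-bar\<^esub> = \<delta>\<^bsub>ik\<^esub>\<close>, the convention under which
  \<open>\<Gamma>\<^bsub>ki\<^esub>\<^sup>j = g\<^bsup>j m-bar\<^esup> \<partial>\<^sub>k g\<^bsub>i m-bar\<^esub>\<close> is the Chern connection. It is therefore the
  \<^emph>\<open>transpose\<close> of the inverse of the matrix \<open>g z\<close>.\<close>

definition ginv :: "'n::finite matfield \<Rightarrow> complex^'n \<Rightarrow> 'n \<Rightarrow> 'n \<Rightarrow> complex" where
  "ginv g z i j = matrix_inv (g z) $ j $ i"

definition trace11 :: "'n::finite matfield \<Rightarrow> 'n matfield \<Rightarrow> complex^'n \<Rightarrow> complex" where
  "trace11 g r z = (\<Sum>i\<in>UNIV. \<Sum>j\<in>UNIV. ginv g z i j * r z $ i $ j)"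

text \<open>\<open>Gam g z k i j\<close> is \<open>\<Gamma>\<^bsub>ki\<^esub>\<^sup>j\<close>; \<open>Tor g z i j k\<close> is \<open>T\<^bsub>ij\<^esub>\<^sup>k\<close>;
  \<open>Tor_low g z i j k\<close> is \<open>T\<^bsub>ij k-bar\<^esub>\<close>.\<close>

definition Gam :: "'n::finite matfield \<Rightarrow> complex^'n \<Rightarrow> 'n \<Rightarrow> 'n \<Rightarrow> 'n \<Rightarrow> complex" where
  "Gam g z k i j = (\<Sum>m\<in>UNIV. ginv g z j m * dz k (\<lambda>w. g w $ i $ m) z)"

definition Tor :: "'n::finite matfield \<Rightarrow> complex^'n \<Rightarrow> 'n \<Rightarrow> 'n \<Rightarrow> 'n \<Rightarrow> complex" where
  "Tor g z i j k = Gam g z i j k - Gam g z j i k"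

definition Tor_low :: "'n::finite matfield \<Rightarrow> complex^'n \<Rightarrow> 'n \<Rightarrow> 'n \<Rightarrow> 'n \<Rightarrow> complex" where
  "Tor_low g z i j k = (\<Sum>m\<in>UNIV. g z $ m $ k * Tor g z i j m)"

text \<open>\<open>Curv g z i j k l\<close> is \<open>R\<^bsub>i j-bar k\<^esub>\<^sup>l\<close>; \<open>Curv_low g z i j k l\<close> is
  \<open>R\<^bsub>i j-bar k l-bar\<^esub>\<close>; likewise \<open>Qten g z i j k l\<close> is \<open>Q\<^bsub>i j-bar k l-bar\<^esub>\<close>.\<close>

definition Curv :: "'n::finite matfield \<Rightarrow> complex^'n \<Rightarrow> 'n \<Rightarrow> 'n \<Rightarrow> 'n \<Rightarrow> 'n \<Rightarrow> complex" where
  "Curv g z i j k l = - dzbar j (\<lambda>w. Gam g w i k l) z"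

definition Curv_low :: "'n::finite matfield \<Rightarrow> complex^'n \<Rightarrow> 'n \<Rightarrow> 'n \<Rightarrow> 'n \<Rightarrow> 'n \<Rightarrow> complex" where
  "Curv_low g z i j k l = (\<Sum>m\<in>UNIV. g z $ m $ l * Curv g z i j k m)"

definition Qten :: "'n::finite matfield \<Rightarrow> complex^'n \<Rightarrow> 'n \<Rightarrow> 'n \<Rightarrow> 'n \<Rightarrow> 'n \<Rightarrow> complex" where
  "Qten g z i j k l = Curv_low g z i j k l
     - (\<Sum>p\<in>UNIV. \<Sum>q\<in>UNIV. ginv g z p q * Tor_low g z k p j * cnj (Tor_low g z l q i))"

text \<open>The coefficients of the Bismut connection on the holomorphic tangent bundle:
  \<open>\<nabla>\<^sup>+\<^sub>i X\<^sup>j = \<partial>\<^sub>i X\<^sup>j + \<Sum>\<^sub>l bismut10 g z i l j X\<^sup>l\<close> and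
  \<open>\<nabla>\<^sup>+\<^bsub>i-bar\<^esub> X\<^sup>j = \<partial>\<^bsub>i-bar\<^esub> X\<^sup>j + \<Sum>\<^sub>l bismut01 g z i l j X\<^sup>l\<close>.\<close>

definition bismut10 :: "'n::finite matfield \<Rightarrow> complex^'n \<Rightarrow> 'n \<Rightarrow> 'n \<Rightarrow> 'n \<Rightarrow> complex" where
  "bismut10 g z i l j = Gam g z l i j"

definition bismut01 :: "'n::finite matfield \<Rightarrow> complex^'n \<Rightarrow> 'n \<Rightarrow> 'n \<Rightarrow> 'n \<Rightarrow> complex" where
  "bismut01 g z i l j = (\<Sum>m\<in>UNIV. ginv g z j m * cnj (Tor_low g z i m l))"

text \<open>The induced connection on forms of type (1,1): \<open>nabla_plus g r z i k m\<close> is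
  \<open>\<nabla>\<^sup>+\<^sub>i r\<^bsub>k m-bar\<^esub>\<close>. It acts on a barred index by the complex conjugate of the
  (0,1)-coefficients.\<close>

definition nabla_plus ::
  "'n::finite matfield \<Rightarrow> 'n matfield \<Rightarrow> complex^'n \<Rightarrow> 'n \<Rightarrow> 'n \<Rightarrow> 'n \<Rightarrow> complex" where
  "nabla_plus g r z i k m = dz i (\<lambda>w. r w $ k $ m) z
     - (\<Sum>l\<in>UNIV. bismut10 g z i k l * r z $ l $ m)
     - (\<Sum>p\<in>UNIV. cnj (bismut01 g z i m p) * r z $ k $ p)"

definition norm2_nabla_plus :: "'n::finite matfield \<Rightarrow> 'n matfield \<Rightarrow> complex^'n \<Rightarrow> complex" where
  "norm2_nabla_plus g r z =
     (\<Sum>i\<in>UNIV. \<Sum>a\<in>UNIV. \<Sum>k\<in>UNIV. \<Sum>b\<in>UNIV. \<Sum>c\<in>UNIV. \<Sum>m\<in>UNIV.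
        ginv g z i a * ginv g z k b * ginv g z c m
        * nabla_plus g r z i k m * cnj (nabla_plus g r z a b c))"

definition norm2_form :: "'n::finite matfield \<Rightarrow> 'n matfield \<Rightarrow> complex^'n \<Rightarrow> complex" where
  "norm2_form g r z =
     (\<Sum>p\<in>UNIV. \<Sum>q\<in>UNIV. \<Sum>k\<in>UNIV. \<Sum>l\<in>UNIV.
        ginv g z p q * ginv g z k l * r z $ k $ q * r z $ p $ l)"

definition square_form :: "'n::finite matfield \<Rightarrow> 'n matfield \<Rightarrow> 'n matfield" where
  "square_form g r z =
     (\<chi> k l. \<Sum>p\<in>UNIV. \<Sum>q\<in>UNIV. ginv g z p q * r z $ k $ q * r z $ p $ l)"

text \<open>\<open>raise11 g r z i j\<close> is \<open>r\<^bsup>i j-bar\<^esup> = g\<^bsup>i q-bar\<^esup> g\<^bsup>p j-bar\<^esup> r\<^bsub>p q-bar\<^esub>\<close>.\<close>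

definition raise11 :: "'n::finite matfield \<Rightarrow> 'n matfield \<Rightarrow> complex^'n \<Rightarrow> 'n \<Rightarrow> 'n \<Rightarrow> complex" where
  "raise11 g r z i j =
     (\<Sum>p\<in>UNIV. \<Sum>q\<in>UNIV. ginv g z i q * ginv g z p j * r z $ p $ q)"


section \<open>The explicit formula for the induced connection\<close>

lemma pos_def_mat_invertible:
  fixes M :: "complex^'n^'n"
  assumes "pos_def_mat M"
  shows "invertible M"
proof -
  have "v = 0" if v: "v v* M = 0" for v :: "complex^'n"
  proof (rule ccontr)
    assume "v \<noteq> 0"
    then have "0 < Re (\<Sum>i\<in>UNIV. \<Sum>j\<in>UNIV. M $ i $ j * v $ i * cnj (v $ j))"
      using assms by (simp add: pos_def_mat_def)
    also have "(\<Sum>i\<in>UNIV. \<Sum>j\<in>UNIV. M $ i $ j * v $ i * cnj (v $ j))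
             = (\<Sum>j\<in>UNIV. (v v* M) $ j * cnj (v $ j))"
      by (subst sum.swap) (simp add: vector_matrix_mult_def sum_distrib_left mult.commute)
    finally show False using v by simp
  qed
  then have "\<forall>v. transpose M *v v = 0 \<longrightarrow> v = 0"
    by simp
  then have "invertible (transpose M)"
    by (metis invertible_left_inverse matrix_left_invertible_ker)
  then show ?thesis
    by (metis invertible_def matrix_transpose_mul transpose_mat transpose_transpose)
qed

lemma cnj_ginv:
  fixes g :: "'n::finite matfield"
  assumes H: "hermitian_mat (g z)" and P: "pos_def_mat (g z)"
  shows "cnj (ginv g z i j) = ginv g z j i"
proof -
  let ?M = "g z" and ?N = "matrix_inv (g z)"
  let ?K = "(\<chi> i j. cnj (?N $ j $ i)) :: complex^'n^'n"
  have inv: "?M ** ?N = mat 1" "?N ** ?M = mat 1"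
    using someI_ex[OF pos_def_mat_invertible[OF P, unfolded invertible_def]]
    by (simp_all add: matrix_inv_def)
  have "(?K ** ?M) $ i $ j = mat 1 $ i $ j" for i j
  proof -
    have "(?K ** ?M) $ i $ j = cnj ((?M ** ?N) $ j $ i)"
      using H by (simp add: matrix_matrix_mult_def hermitian_mat_def mult.commute)
    then show ?thesis
      by (simp add: inv mat_def)
  qed
  then have "?K ** ?M = mat 1"
    by (simp add: vec_eq_iff)
  then have "?K = ?N"
    by (metis inv(1) matrix_mul_assoc matrix_mul_lid matrix_mul_rid)
  then have "?K $ i $ j = ?N $ i $ j"
    by simp
  then show ?thesis
    by (simp add: ginv_def)
qed

lemma nabla_plus_explicit:
  assumes "hermitian_mat (g z)" and "pos_def_mat (g z)"
  shows "nabla_plus g r z i k m = dz i (\<lambda>w. r w $ k $ m) z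
     - (\<Sum>l\<in>UNIV. Gam g z k i l * r z $ l $ m)
     - (\<Sum>q\<in>UNIV. \<Sum>p\<in>UNIV. ginv g z q p * Tor_low g z i q m * r z $ k $ p)"
proof -
  have "(\<Sum>p\<in>UNIV. cnj (bismut01 g z i m p) * r z $ k $ p)
      = (\<Sum>q\<in>UNIV. \<Sum>p\<in>UNIV. ginv g z q p * Tor_low g z i q m * r z $ k $ p)"
    by (subst sum.swap) (simp add: bismut01_def cnj_ginv[of g z, OF assms] sum_distrib_right)
  then show ?thesis
    by (simp add: nabla_plus_def bismut10_def)
qed

end

theory Submission
  imports Defs
begin

text \<open>The formula is a local computation. Raising every barred index with the inverse metric turns \<open>\<rho>\<close> into
  the endomorphism \<open>P = \<rho> g\<^sup>-\<^sup>1\<close>, with \<open>|\<rho>|\<^sup>2 = tr P\<^sup>2\<close> and \<open>tr P\<close> constant, and all contractions become matrix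
  products and traces. Closedness of \<open>\<rho>\<close> turns the Laplacian \<open>g\<^bsup>i j-bar\<^esup> \<partial>\<^sub>i \<partial>\<^bsub>j-bar\<^esub> \<rho>\<^bsub>k m-bar\<^esub>\<close> into
  \<open>g\<^bsup>i j-bar\<^esup> \<partial>\<^sub>k \<partial>\<^bsub>m-bar\<^esub> \<rho>\<^bsub>i j-bar\<^esub>\<close>, which constancy of the trace expresses by lower order derivatives of \<open>\<rho>\<close>
  and derivatives of \<open>g\<close>. The remaining terms are matched through cyclicity of the trace and the exchange
  of a derivative index with a matrix index.\<close>

subsection \<open>Matrix algebra\<close>

lemma matrix_sub_ldistrib: "A ** (B - C) = A ** B - A ** C" for A :: "'a::ring_1^'n^'m"
  by (simp add: vec_eq_iff matrix_matrix_mult_def sum_subtractf right_diff_distrib)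

lemma matrix_sub_rdistrib: "(A - B) ** C = A ** C - B ** C" for A :: "'a::ring_1^'n^'m"
  by (simp add: vec_eq_iff matrix_matrix_mult_def sum_subtractf left_diff_distrib)

lemma matrix_add_rdistrib: "(A + B) ** C = A ** C + B ** C" for A :: "'a::semiring_1^'n^'m"
  by (simp add: vec_eq_iff matrix_matrix_mult_def sum.distrib distrib_right)

lemma matrix_neg_left: "(- A) ** B = - (A ** B)" for A :: "'a::ring_1^'n^'m"
  by (simp add: vec_eq_iff matrix_matrix_mult_def sum_negf)

lemma matrix_neg_right: "A ** (- B) = - (A ** B)" for A :: "'a::ring_1^'n^'m"
  by (simp add: vec_eq_iff matrix_matrix_mult_def sum_negf)

lemma trace_neg: "trace (- A) = - trace A" for A :: "'a::comm_ring_1^'n^'n"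
  by (simp add: trace_def sum_negf)

lemmas matrix_expand = matrix_add_ldistrib matrix_add_rdistrib matrix_sub_ldistrib
  matrix_sub_rdistrib matrix_neg_left matrix_neg_right trace_add trace_sub trace_neg

text \<open>With \<open>M\<close> the inverse of the metric matrix this raises the barred index \<open>q\<close> of \<open>Y\<close>,
  since \<open>M $ q $ i\<close> is \<open>g\<^bsup>i q-bar\<^esup>\<close>.\<close>

definition contract :: "complex^'n^'n \<Rightarrow> ('n \<Rightarrow> complex^'n^'n) \<Rightarrow> 'n \<Rightarrow> complex^'n^'n" where
  "contract M Y i = (\<chi> k l. \<Sum>q\<in>UNIV. M $ q $ i * Y q $ k $ l)"

lemma contract_mult_left: "X ** contract M Y i = contract M (\<lambda>q. X ** Y q) i"
  unfolding vec_eq_iff contract_def matrix_matrix_mult_def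
  by (auto simp: sum_distrib_left mult.left_commute intro: sum.swap)

lemma contract_mult_right: "contract M Y i ** X = contract M (\<lambda>q. Y q ** X) i"
  unfolding vec_eq_iff contract_def matrix_matrix_mult_def
  by (auto simp: sum_distrib_left sum_distrib_right mult.assoc intro: sum.swap)

lemma contract_add: "contract M (\<lambda>q. Y q + Z q) i = contract M Y i + contract M Z i"
  by (simp add: contract_def vec_eq_iff distrib_left sum.distrib)

lemma contract_diff: "contract M (\<lambda>q. Y q - Z q) i = contract M Y i - contract M Z i"
  by (simp add: contract_def vec_eq_iff right_diff_distrib sum_subtractf)

lemma trace_contract: "trace (contract M Y i) = (\<Sum>q\<in>UNIV. M $ q $ i * trace (Y q))"
  unfolding contract_def trace_def by (simp add: sum_distrib_left) (rule sum.swap)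

text \<open>The trace joins the row index of the first factor to the column index of the last.
  Priming exchanges precisely these two indices with the summation index \<open>i\<close>, so the
  two sums differ by renaming indices.\<close>

lemma sum_trace_transpose13:
  fixes X X' Z Z' :: "'n::finite \<Rightarrow> complex^'n^'n"
  assumes "\<And>i k l. X' i $ k $ l = X k $ i $ l" and "\<And>i k l. Z' i $ k $ l = Z l $ k $ i"
  shows "(\<Sum>i\<in>UNIV. trace (X' i ** Y ** Z' i)) = (\<Sum>i\<in>UNIV. trace (X i ** Y ** Z i))"
proof -
  have "(Y ** Z' i) $ l $ k = (Y ** Z k) $ l $ i" for i k l
    by (simp add: matrix_matrix_mult_def assms(2))
  then have "(X' i ** (Y ** Z' i)) $ k $ k = (X k ** (Y ** Z k)) $ i $ i" for i k
    by (simp add: matrix_matrix_mult_def[of "X' i"] matrix_matrix_mult_def[of "X k"] assms(1))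
  then show ?thesis
    unfolding trace_def matrix_mul_assoc[symmetric] by simp (rule sum.swap)
qed

lemma trace_mult_eq_sum: "trace (A ** B) = (\<Sum>i\<in>UNIV. \<Sum>j\<in>UNIV. A $ i $ j * B $ j $ i)"
  by (simp add: trace_def matrix_matrix_mult_def)

text \<open>The formula at a point, with all barred indices raised: \<open>P\<close> is \<open>\<rho>\<close> as an endomorphism,
  \<open>\<alpha>\<close>, \<open>\<epsilon>\<close> (\<open>\<beta>\<close>, \<open>\<eta>\<close>) are the (anti)holomorphic derivatives of \<open>g\<close>, \<open>\<rho>\<close>, and \<open>B\<close>, \<open>F\<close> are their
  mixed second derivatives. Closedness of \<open>\<rho>\<close> is the symmetry of \<open>\<epsilon>\<close>, \<open>\<eta>\<close>, \<open>F\<close>; \<open>trF\<close> says that the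
  mixed second derivatives of the trace of \<open>\<rho>\<close> vanish. \<open>V\<close> and \<open>W\<close> stand
  for \<open>\<nabla>\<^sup>+\<rho>\<close> and its conjugate.\<close>

lemma bochner_identity_algebraic:
  fixes P :: "complex^'n^'n" and \<alpha> \<epsilon> \<alpha>' \<beta> \<eta> \<beta>' V W :: "'n \<Rightarrow> complex^'n^'n"
    and B F :: "'n \<Rightarrow> 'n \<Rightarrow> complex^'n^'n"
  assumes \<alpha>': "\<And>i k l. \<alpha>' i $ k $ l = \<alpha> k $ i $ l"
    and \<beta>': "\<And>i k l. \<beta>' i $ k $ l = \<beta> l $ k $ i"
    and \<epsilon>: "\<And>i k l. \<epsilon> i $ k $ l = \<epsilon> k $ i $ l"
    and \<eta>: "\<And>i k l. \<eta> i $ k $ l = \<eta> l $ k $ i"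
    and F1: "\<And>i j k l. F i j $ k $ l = F k j $ i $ l"
    and F2: "\<And>i j k l. F i j $ k $ l = F i l $ k $ j"
    and trF: "\<And>k m. trace (F k m) = trace (\<eta> m ** \<alpha> k) + trace (\<epsilon> k ** \<beta> m)
      + trace (P ** B k m) - trace (P ** \<alpha> k ** \<beta> m) - trace (P ** \<beta> m ** \<alpha> k)"
    and V: "\<And>i. V i = \<epsilon> i - P ** \<alpha> i + P ** \<alpha>' i - \<alpha>' i ** P"
    and W: "\<And>i. W i = \<eta> i - \<beta> i ** P - P ** \<beta>' i + \<beta>' i ** P"
    and Q: "\<And>i j k l. Q i j k l = (\<alpha> i ** \<beta> j - B i j) $ k $ l
      - (\<Sum>p\<in>UNIV. (\<alpha>' p - \<alpha> p) $ k $ j * (\<beta>' p - \<beta> p) $ i $ l)"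
  shows "(\<Sum>i\<in>UNIV. trace ((\<epsilon> i - P ** \<alpha> i) ** (\<eta> i - P ** \<beta> i))
      + trace (P ** (F i i - \<eta> i ** \<alpha> i - \<epsilon> i ** \<beta> i
          + P ** (\<alpha> i ** \<beta> i + \<beta> i ** \<alpha> i - B i i))))
    = (\<Sum>i\<in>UNIV. trace (V i ** W i))
      + (\<Sum>i\<in>UNIV. \<Sum>j\<in>UNIV. \<Sum>k\<in>UNIV. \<Sum>l\<in>UNIV.
          Q i j k l * (mat 1 $ j $ i * (P ** P) $ l $ k - P $ j $ i * P $ l $ k))"
proof -
  let ?s = "\<lambda>f. \<Sum>i\<in>UNIV. trace (f i :: complex^'n^'n)"
  note assoc = matrix_mul_assoc[symmetric]
  have cyc: "trace (X ** Y ** Z) = trace (Y ** Z ** X)" for X Y Z :: "complex^'n^'n"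
    by (metis matrix_mul_assoc trace_mul_sym)
  have QB: "(\<Sum>i\<in>UNIV. \<Sum>j\<in>UNIV. \<Sum>k\<in>UNIV. \<Sum>l\<in>UNIV. Y i j $ k $ l * (M $ j $ i * K $ l $ k))
      = ?s (\<lambda>i. contract M (\<lambda>j. Y i j ** K) i)" for Y :: "'n \<Rightarrow> 'n \<Rightarrow> complex^'n^'n" and M K
    by (simp add: trace_contract trace_mult_eq_sum sum_distrib_left mult_ac)
  have QT: "(\<Sum>i\<in>UNIV. \<Sum>j\<in>UNIV. \<Sum>k\<in>UNIV. \<Sum>l\<in>UNIV.
        (\<Sum>p\<in>UNIV. X p $ k $ j * Y p $ i $ l) * (M $ j $ i * K $ l $ k))
      = ?s (\<lambda>p. X p ** M ** Y p ** K)" (is "?L = ?R") for X Y :: "'n \<Rightarrow> complex^'n^'n" and M K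
  proof -
    have "?R = (\<Sum>p\<in>UNIV. \<Sum>k\<in>UNIV. \<Sum>i\<in>UNIV. \<Sum>j\<in>UNIV. \<Sum>l\<in>UNIV. X p $ k $ j * M $ j $ i * (Y p $ i $ l * K $ l $ k))"
      unfolding assoc[of "X _ ** M"]
      by (simp add: trace_mult_eq_sum) (simp add: matrix_matrix_mult_def sum_product)
    also have "\<dots> = ?L"
      unfolding sum_distrib_right sum.cartesian_product
      by (rule sum.reindex_bij_witness[of _ "\<lambda>(i,j,k,l,p). (p,k,i,j,l)" "\<lambda>(p,k,i,j,l). (i,j,k,l,p)"])
        (auto simp: mult_ac)
    finally show ?thesis by simp
  qed
  \<comment> \<open>Needed for \<open>M = mat 1\<close>, \<open>K = P ** P\<close> and for
    \<open>M = K = P\<close>, the two terms of the bracket that multiplies \<open>Q\<close>. The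
    curvature part becomes a contraction, the torsion part a trace of a product.\<close>
  have Qsum: "(\<Sum>i\<in>UNIV. \<Sum>j\<in>UNIV. \<Sum>k\<in>UNIV. \<Sum>l\<in>UNIV. Q i j k l * (M $ j $ i * K $ l $ k))
    = ?s (\<lambda>i. contract M (\<lambda>j. (\<alpha> i ** \<beta> j - B i j) ** K) i)
      - ?s (\<lambda>p. (\<alpha>' p - \<alpha> p) ** M ** (\<beta>' p - \<beta> p) ** K)" for M K
    unfolding Q QB[symmetric] QT[symmetric] by (simp add: left_diff_distrib sum_subtractf)
  have c1: "contract (mat 1) Y i = Y i" for Y :: "'n \<Rightarrow> complex^'n^'n" and i
    by (simp add: contract_def mat_def vec_eq_iff if_distrib[of "\<lambda>x. x * _"] cong: if_cong)
  \<comment> \<open>Closedness moves the contraction from the derivative indices of \<open>F\<close> to its matrix indices.\<close>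
  have FF: "?s (\<lambda>i. P ** F i i) = (\<Sum>k\<in>UNIV. \<Sum>m\<in>UNIV. P $ m $ k * trace (F k m))"
  proof -
    have "F i i $ k $ m = F k m $ i $ i" for i k m
      by (metis F1 F2)
    then have "?s (\<lambda>i. P ** F i i) = (\<Sum>i\<in>UNIV. \<Sum>m\<in>UNIV. \<Sum>k\<in>UNIV. P $ m $ k * F k m $ i $ i)"
      unfolding trace_mult_eq_sum by (intro sum.cong refl arg_cong[of _ _ "(*) _"])
    also have "\<dots> = (\<Sum>k\<in>UNIV. \<Sum>m\<in>UNIV. P $ m $ k * trace (F k m))"
      unfolding sum_distrib_left trace_def sum.cartesian_product
      by (rule sum.reindex_bij_witness[of _ "\<lambda>(k,m,i). (i,m,k)" "\<lambda>(i,m,k). (k,m,i)"]) auto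
    finally show ?thesis .
  qed
  have trF': "trace (F k m) = trace (\<alpha> k ** \<eta> m) + trace (\<epsilon> k ** \<beta> m)
      + trace (B k m ** P) - trace (\<alpha> k ** \<beta> m ** P) - trace (\<alpha> k ** P ** \<beta> m)" for k m
    unfolding trF trace_mul_sym[of "\<eta> m"] trace_mul_sym[of P "B k m"] cyc[of P] cyc[of "\<beta> m" "\<alpha> k" P, symmetric]
    using cyc[of P "\<beta> m" "\<alpha> k"] cyc[of "\<beta> m" "\<alpha> k" P] by simp
  \<comment> \<open>The factors \<open>mat 1\<close> give these terms the three-factor shape of
    \<open>sum_trace_transpose13\<close>.\<close>
  have FF': "?s (\<lambda>i. P ** F i i) = ?s (\<lambda>k. \<alpha> k ** mat 1 ** contract P \<eta> k)
      + ?s (\<lambda>k. \<epsilon> k ** mat 1 ** contract P \<beta> k) + ?s (\<lambda>k. contract P (\<lambda>m. B k m ** P) k)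
      - ?s (\<lambda>k. contract P (\<lambda>m. \<alpha> k ** \<beta> m ** P) k) - ?s (\<lambda>k. \<alpha> k ** P ** contract P \<beta> k)"
    unfolding FF trF'
    by (simp add: contract_mult_left trace_contract sum.distrib sum_subtractf algebra_simps)
  \<comment> \<open>Exchanging the derivative index with a matrix index turns the contraction of
    \<open>Z\<close> with \<open>P\<close> over the derivative index into a matrix product with
    \<open>P\<close>.\<close>
  have sw: "?s (\<lambda>i. \<alpha>' i ** Y ** (Z' i ** P)) = ?s (\<lambda>k. \<alpha> k ** Y ** contract P Z k)"
    if "\<And>i k l. Z' i $ k $ l = Z l $ k $ i" for Z Z' and Y :: "complex^'n^'n"
    by (rule sum_trace_transpose13[OF \<alpha>']) (simp add: matrix_matrix_mult_def contract_def that mult.commute)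
  have a: "?s (\<lambda>k. \<alpha> k ** mat 1 ** contract P \<eta> k) = ?s (\<lambda>i. \<alpha>' i ** mat 1 ** (\<eta> i ** P))"
    by (rule sw[symmetric]) (rule \<eta>)
  have d: "?s (\<lambda>k. \<alpha> k ** P ** contract P \<beta> k) = ?s (\<lambda>i. \<alpha>' i ** P ** (\<beta>' i ** P))"
    by (rule sw[symmetric]) (rule \<beta>')
  have b: "?s (\<lambda>k. \<epsilon> k ** mat 1 ** contract P \<beta> k) = ?s (\<lambda>i. \<epsilon> i ** mat 1 ** (\<beta>' i ** P))"
    by (rule sum_trace_transpose13[symmetric, OF \<epsilon>]) (simp add: matrix_matrix_mult_def contract_def \<beta>' mult.commute)
  \<comment> \<open>These three exchanges turn the terms of \<open>trace (V i ** W i)\<close> in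
    which \<open>P\<close> stands between two derivatives, one or both of them primed, into terms of
    the left side.\<close>
  have e: "?s (\<lambda>i. \<epsilon> i ** P ** \<beta>' i) = ?s (\<lambda>i. \<epsilon> i ** P ** \<beta> i)"
    by (rule sum_trace_transpose13[OF \<epsilon> \<beta>'])
  have f: "?s (\<lambda>i. \<alpha>' i ** P ** \<eta> i) = ?s (\<lambda>i. \<alpha> i ** P ** \<eta> i)"
    by (rule sum_trace_transpose13[OF \<alpha>' \<eta>])
  have g: "?s (\<lambda>i. \<alpha>' i ** (P ** P) ** \<beta>' i) = ?s (\<lambda>i. \<alpha> i ** (P ** P) ** \<beta> i)"
    by (rule sum_trace_transpose13[OF \<alpha>' \<beta>'])
  have rot: "trace (P ** (X ** Y)) = trace (X ** (Y ** P))"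
    "trace (P ** (P ** (X ** Y))) = trace (X ** (Y ** (P ** P)))"
    "trace (P ** X) = trace (X ** P)" "trace (P ** (P ** X)) = trace (X ** (P ** P))" for X Y
    by (metis matrix_mul_assoc trace_mul_sym)+
  have rot_bar: "trace (\<eta> i ** X) = trace (X ** \<eta> i)" "trace (\<beta> i ** X) = trace (X ** \<beta> i)"
    "trace (\<beta>' i ** X) = trace (X ** \<beta>' i)" for i X
    by (rule trace_mul_sym)+
  \<comment> \<open>Cyclic rotation is instantiated at the letters other than \<open>P\<close>:
    leading factors \<open>P\<close> move to the end, and equal traces reach the same form.\<close>
  note rots = rot(1,2)[of "\<alpha> _"] rot(1,2)[of "\<alpha>' _"] rot(1,2)[of "\<epsilon> _"]
    rot(1,2)[of "\<eta> _"] rot(1,2)[of "\<beta> _"] rot(1,2)[of "\<beta>' _"] rot(3,4)[of "F _ _"] rot(3,4)[of "B _ _"]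
  show ?thesis
    using FF' unfolding a b d using e f g
    by (simp add: V W Qsum right_diff_distrib sum_subtractf c1 matrix_expand sum.distrib sum_negf assoc rots rot_bar
      contract_diff flip: sum_distrib_left)
qed

subsection \<open>Symmetry of second derivatives\<close>

text \<open>The mean value theorem is applied twice: along \<open>u\<close> to the increment of
  \<open>f\<close> in the direction \<open>v\<close>, then along \<open>v\<close> to the derivative
  in the direction \<open>u\<close>.\<close>

lemma second_difference_mean_value:
  fixes f :: "'a::real_normed_vector \<Rightarrow> real"
  assumes f': "\<And>x. x \<in> S \<Longrightarrow> (f has_derivative f' x) (at x)"
    and f'': "\<And>x. x \<in> S \<Longrightarrow> ((\<lambda>y. f' y u) has_derivative f'' x) (at x)"
    and box: "\<And>\<sigma> \<tau>. 0 \<le> \<sigma> \<Longrightarrow> \<sigma> \<le> s \<Longrightarrow> 0 \<le> \<tau> \<Longrightarrow> \<tau> \<le> s \<Longrightarrow> x + \<sigma> *\<^sub>R u + \<tau> *\<^sub>R v \<in> S"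
    and s: "0 < s"
  obtains \<sigma> \<tau> where "0 < \<sigma>" "\<sigma> < s" "0 < \<tau>" "\<tau> < s"
    "f (x + s *\<^sub>R u + s *\<^sub>R v) - f (x + s *\<^sub>R u) - f (x + s *\<^sub>R v) + f x
      = s * s * f'' (x + \<sigma> *\<^sub>R u + \<tau> *\<^sub>R v) v"
proof -
  \<comment> \<open>The summand \<open>0 *\<^sub>R v\<close> keeps both terms in the shape covered
    by \<open>d1\<close>.\<close>
  let ?\<phi> = "\<lambda>\<sigma>. f (x + \<sigma> *\<^sub>R u + s *\<^sub>R v) - f (x + \<sigma> *\<^sub>R u + 0 *\<^sub>R v)"
  have d1: "DERIV (\<lambda>\<sigma>. f (x + \<sigma> *\<^sub>R u + \<tau> *\<^sub>R v)) \<sigma> :> f' (x + \<sigma> *\<^sub>R u + \<tau> *\<^sub>R v) u"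
    if "0 \<le> \<sigma>" "\<sigma> \<le> s" "0 \<le> \<tau>" "\<tau> \<le> s" for \<sigma> \<tau>
  proof -
    have l: "linear (f' (x + \<sigma> *\<^sub>R u + \<tau> *\<^sub>R v))"
      using f'[OF box[OF that]] by (rule has_derivative_linear)
    have "((\<lambda>\<sigma>. x + \<sigma> *\<^sub>R u + \<tau> *\<^sub>R v) has_derivative (\<lambda>h. h *\<^sub>R u)) (at \<sigma>)"
      by (auto intro!: derivative_eq_intros)
    from diff_chain_at[OF this f'[OF box[OF that]]] show ?thesis
      by (simp add: o_def has_field_derivative_def linear_scale[OF l] mult.commute[of _ "f' _ u"])
  qed
  have d2: "DERIV (\<lambda>\<tau>. f' (x + \<sigma> *\<^sub>R u + \<tau> *\<^sub>R v) u) \<tau> :> f'' (x + \<sigma> *\<^sub>R u + \<tau> *\<^sub>R v) v"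
    if "0 \<le> \<sigma>" "\<sigma> \<le> s" "0 \<le> \<tau>" "\<tau> \<le> s" for \<sigma> \<tau>
  proof -
    have l: "linear (f'' (x + \<sigma> *\<^sub>R u + \<tau> *\<^sub>R v))"
      using f''[OF box[OF that]] by (rule has_derivative_linear)
    have "((\<lambda>\<tau>. x + \<sigma> *\<^sub>R u + \<tau> *\<^sub>R v) has_derivative (\<lambda>h. h *\<^sub>R v)) (at \<tau>)"
      by (auto intro!: derivative_eq_intros)
    from diff_chain_at[OF this f''[OF box[OF that]]] show ?thesis
      by (simp add: o_def has_field_derivative_def linear_scale[OF l] mult.commute[of _ "f'' _ v"])
  qed
  obtain \<sigma> where \<sigma>: "0 < \<sigma>" "\<sigma> < s"
    and e1: "?\<phi> s - ?\<phi> 0 = (s - 0) * (f' (x + \<sigma> *\<^sub>R u + s *\<^sub>R v) u - f' (x + \<sigma> *\<^sub>R u + 0 *\<^sub>R v) u)"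
    using MVT2[OF s, of ?\<phi> "\<lambda>\<sigma>. f' (x + \<sigma> *\<^sub>R u + s *\<^sub>R v) u - f' (x + \<sigma> *\<^sub>R u + 0 *\<^sub>R v) u"]
      DERIV_diff[OF d1[of _ s] d1[of _ 0]] s by auto
  obtain \<tau> where \<tau>: "0 < \<tau>" "\<tau> < s"
    and e2: "f' (x + \<sigma> *\<^sub>R u + s *\<^sub>R v) u - f' (x + \<sigma> *\<^sub>R u + 0 *\<^sub>R v) u
      = (s - 0) * f'' (x + \<sigma> *\<^sub>R u + \<tau> *\<^sub>R v) v"
    using MVT2[OF s, of "\<lambda>\<tau>. f' (x + \<sigma> *\<^sub>R u + \<tau> *\<^sub>R v) u" "\<lambda>\<tau>. f'' (x + \<sigma> *\<^sub>R u + \<tau> *\<^sub>R v) v"] d2 \<sigma> by auto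
  from that[OF \<sigma> \<tau>] e1 e2 show thesis
    by (simp add: algebra_simps)
qed

text \<open>The second difference over a parallelogram is symmetric in \<open>u\<close> and
  \<open>v\<close>. Its two mean value expressions evaluate the two mixed derivatives at points near
  \<open>x\<close>, and continuity at \<open>x\<close> compares them there.\<close>

lemma second_derivative_symmetric_real:
  fixes f :: "'a::real_normed_vector \<Rightarrow> real"
  assumes "open S" "x \<in> S"
    and f': "\<And>x. x \<in> S \<Longrightarrow> (f has_derivative f' x) (at x)"
    and fu: "\<And>x. x \<in> S \<Longrightarrow> ((\<lambda>y. f' y u) has_derivative fu x) (at x)"
    and fv: "\<And>x. x \<in> S \<Longrightarrow> ((\<lambda>y. f' y v) has_derivative fv x) (at x)"
    and cu: "isCont (\<lambda>y. fu y v) x" and cv: "isCont (\<lambda>y. fv y u) x"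
  shows "fu x v = fv x u"
proof (rule ccontr)
  assume "fu x v \<noteq> fv x u"
  \<comment> \<open>Half the gap: two errors smaller than \<open>e\<close> cannot add up to
    it.\<close>
  define e where "e = \<bar>fu x v - fv x u\<bar> / 2"
  have e: "e > 0" using \<open>fu x v \<noteq> fv x u\<close> by (simp add: e_def)
  obtain d0 where d0: "d0 > 0" "ball x d0 \<subseteq> S"
    using assms(1,2) open_contains_ball by blast
  obtain d1 where d1: "d1 > 0" "\<And>y. dist y x < d1 \<Longrightarrow> dist (fu y v) (fu x v) < e"
    using cu e unfolding continuous_at_eps_delta by blast
  obtain d2 where d2: "d2 > 0" "\<And>y. dist y x < d2 \<Longrightarrow> dist (fv y u) (fv x u) < e"
    using cv e unfolding continuous_at_eps_delta by blast
  define d where "d = min d0 (min d1 d2)"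
  \<comment> \<open>Makes the parallelogram with sides \<open>s *\<^sub>R u\<close> and
    \<open>s *\<^sub>R v\<close> fit into the ball of radius \<open>d\<close>; the summand 1 keeps
    the denominator positive when both vectors vanish.\<close>
  define s where "s = d / (2 * (norm u + norm v + 1))"
  have d: "d > 0" and s: "s > 0"
    using d0 d1 d2 by (auto simp: d_def s_def add_nonneg_pos)
  have near: "dist (x + \<sigma> *\<^sub>R u + \<tau> *\<^sub>R v) x < d" if "0 \<le> \<sigma>" "\<sigma> \<le> s" "0 \<le> \<tau>" "\<tau> \<le> s" for \<sigma> \<tau>
  proof -
    have "norm (\<sigma> *\<^sub>R u + \<tau> *\<^sub>R v) \<le> \<sigma> * norm u + \<tau> * norm v"
      using that by (intro order_trans[OF norm_triangle_ineq]) simp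
    also have "\<dots> \<le> s * norm u + s * norm v"
      using that by (intro add_mono mult_right_mono) auto
    also have "\<dots> < s * (norm u + norm v + 1) * 2"
      using s by (simp add: algebra_simps add_pos_nonneg add_nonneg_pos)
    also have "\<dots> = d"
      using add_nonneg_pos[of "norm u + norm v" 1] by (simp add: s_def field_simps)
    finally show ?thesis by (simp add: dist_norm add.assoc)
  qed
  have box: "x + \<sigma> *\<^sub>R u + \<tau> *\<^sub>R v \<in> S" if "0 \<le> \<sigma>" "\<sigma> \<le> s" "0 \<le> \<tau>" "\<tau> \<le> s" for \<sigma> \<tau>
    using near[OF that] d0 by (auto simp: d_def dist_commute)
  have box': "x + \<sigma> *\<^sub>R v + \<tau> *\<^sub>R u \<in> S" if "0 \<le> \<sigma>" "\<sigma> \<le> s" "0 \<le> \<tau>" "\<tau> \<le> s" for \<sigma> \<tau>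
    using box[of \<tau> \<sigma>] that by (simp add: add_ac)
  obtain \<sigma> \<tau> where 1: "0 < \<sigma>" "\<sigma> < s" "0 < \<tau>" "\<tau> < s"
    "f (x + s *\<^sub>R u + s *\<^sub>R v) - f (x + s *\<^sub>R u) - f (x + s *\<^sub>R v) + f x
      = s * s * fu (x + \<sigma> *\<^sub>R u + \<tau> *\<^sub>R v) v"
    using second_difference_mean_value[OF f' fu box s] by blast
  obtain \<sigma>' \<tau>' where 2: "0 < \<sigma>'" "\<sigma>' < s" "0 < \<tau>'" "\<tau>' < s"
    "f (x + s *\<^sub>R v + s *\<^sub>R u) - f (x + s *\<^sub>R v) - f (x + s *\<^sub>R u) + f x
      = s * s * fv (x + \<sigma>' *\<^sub>R v + \<tau>' *\<^sub>R u) u"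
    using second_difference_mean_value[OF f' fv box' s] by blast
  have swap: "x + a *\<^sub>R v + b *\<^sub>R u = x + b *\<^sub>R u + a *\<^sub>R v" for a b
    by simp
  have "s * s * fu (x + \<sigma> *\<^sub>R u + \<tau> *\<^sub>R v) v = s * s * fv (x + \<tau>' *\<^sub>R u + \<sigma>' *\<^sub>R v) u"
    using 1(5) 2(5) unfolding swap by linarith
  then have "fu (x + \<sigma> *\<^sub>R u + \<tau> *\<^sub>R v) v = fv (x + \<tau>' *\<^sub>R u + \<sigma>' *\<^sub>R v) u"
    using s by simp
  moreover have "dist (fu (x + \<sigma> *\<^sub>R u + \<tau> *\<^sub>R v) v) (fu x v) < e"
    using 1 near[of \<sigma> \<tau>] by (intro d1(2)) (simp add: d_def)
  moreover have "dist (fv (x + \<tau>' *\<^sub>R u + \<sigma>' *\<^sub>R v) u) (fv x u) < e"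
    using 2 near[of \<tau>' \<sigma>'] by (intro d2(2)) (simp add: d_def)
  ultimately have "\<bar>fu x v - fv x u\<bar> < e + e"
    by (simp add: dist_real_def)
  then show False by (simp add: e_def)
qed

text \<open>Inner products with the basis vectors reduce the claim to real-valued functions.\<close>

lemma second_derivative_symmetric:
  fixes f :: "'a::real_normed_vector \<Rightarrow> 'b::euclidean_space"
  assumes S: "open S" "x \<in> S" and f: "Ck_on 2 S f"
  shows "frechet_derivative (\<lambda>y. frechet_derivative f (at y) u) (at x) v
    = frechet_derivative (\<lambda>y. frechet_derivative f (at y) v) (at x) u"
proof (rule euclidean_eqI)
  fix b :: 'b assume "b \<in> Basis"
  let ?D = "\<lambda>y. frechet_derivative f (at y)"
  let ?D2 = "\<lambda>w y. frechet_derivative (\<lambda>y. ?D y w) (at y)"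
  have D: "(f has_derivative ?D y) (at y)" "((\<lambda>y. ?D y w) has_derivative ?D2 w y) (at y)"
    "continuous_on S (\<lambda>y. ?D2 w y w')" if "y \<in> S" for y w w'
    using f that by (simp_all add: numeral_2_eq_2 frechet_derivative_works)
  have D_inner: "((\<lambda>y. ?D y w \<bullet> b) has_derivative (\<lambda>h. ?D2 w y h \<bullet> b)) (at y)" if "y \<in> S" for y w
    using D(2)[OF that] by (rule has_derivative_inner_left)
  have cont: "isCont (\<lambda>y. ?D2 w y w' \<bullet> b) x" for w w'
    using D(3)[OF S(2)] S by (intro continuous_intros) (simp add: continuous_on_eq_continuous_at)
  show "?D2 u x v \<bullet> b = ?D2 v x u \<bullet> b"
    by (rule second_derivative_symmetric_real[OF S has_derivative_inner_left[OF D(1)] D_inner D_inner cont cont])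
qed

subsection \<open>Wirtinger calculus\<close>

text \<open>Treats \<open>dz\<close> (\<open>s = - \<i>\<close>) and \<open>dzbar\<close> (\<open>s = \<i>\<close>) uniformly.\<close>

definition wirt :: "complex \<Rightarrow> 'n \<Rightarrow> (complex^'n \<Rightarrow> complex) \<Rightarrow> complex^'n \<Rightarrow> complex" where
  "wirt s i f z = (frechet_derivative f (at z) (axis i 1) + s * frechet_derivative f (at z) (axis i \<i>)) / 2"

lemma dz_eq_wirt: "dz = wirt (- \<i>)" and dzbar_eq_wirt: "dzbar = wirt \<i>"
  by (auto simp: fun_eq_iff dz_def dzbar_def wirt_def)

lemma wirt_eq:
  assumes "(f has_derivative f') (at z)"
  shows "wirt s i f z = (f' (axis i 1) + s * f' (axis i \<i>)) / 2"
  using frechet_derivative_at[OF assms] by (simp add: wirt_def)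

lemma wirt_cong:
  assumes "open S" "z \<in> S" "\<And>w. w \<in> S \<Longrightarrow> f w = h w"
  shows "wirt s i f z = wirt s i h z"
proof (cases "f differentiable (at z)")
  case True
  then show ?thesis
    using frechet_derivative_transform_within_open[OF _ assms(1,2), of f h] assms(3) by (simp add: wirt_def)
next
  case False
  \<comment> \<open>\<open>frechet_derivative\<close> chooses among all derivatives. Functions that
    agree near \<open>z\<close> have the same derivatives there, so the default value is the same as
    well.\<close>
  have "(f has_derivative D) (at z) \<longleftrightarrow> (h has_derivative D) (at z)" for D
    by (intro iffI; erule has_derivative_transform_within_open[OF _ assms(1,2)]) (simp_all add: assms(3))
  with False show ?thesis
    by (simp add: wirt_def frechet_derivative_def)
qed

lemma wirt_const: "wirt s i (\<lambda>w. c) z = 0"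
  by (simp add: wirt_def)

lemma wirt_add:
  assumes "f differentiable (at z)" "h differentiable (at z)"
  shows "wirt s i (\<lambda>w. f w + h w) z = wirt s i f z + wirt s i h z"
  by (subst wirt_eq[OF has_derivative_add[OF assms[unfolded frechet_derivative_works]]])
    (simp add: wirt_def field_simps)

lemma wirt_diff:
  assumes "f differentiable (at z)" "h differentiable (at z)"
  shows "wirt s i (\<lambda>w. f w - h w) z = wirt s i f z - wirt s i h z"
  by (subst wirt_eq[OF has_derivative_diff[OF assms[unfolded frechet_derivative_works]]])
    (simp add: wirt_def field_simps)

lemma wirt_mult:
  assumes "f differentiable (at z)" "h differentiable (at z)"
  shows "wirt s i (\<lambda>w. f w * h w) z = wirt s i f z * h z + f z * wirt s i h z"
  by (subst wirt_eq[OF has_derivative_mult[OF assms[unfolded frechet_derivative_works]]])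
    (simp add: wirt_def field_simps)

lemma wirt_sum:
  assumes "\<And>a. a \<in> I \<Longrightarrow> f a differentiable (at z)"
  shows "wirt s i (\<lambda>w. \<Sum>a\<in>I. f a w) z = (\<Sum>a\<in>I. wirt s i (f a) z)"
proof -
  have "((\<lambda>w. \<Sum>a\<in>I. f a w) has_derivative (\<lambda>h. \<Sum>a\<in>I. frechet_derivative (f a) (at z) h)) (at z)"
    using assms by (intro has_derivative_sum) (simp add: frechet_derivative_works[symmetric])
  then show ?thesis
    by (subst wirt_eq) (simp_all add: wirt_def sum.distrib flip: sum_distrib_left sum_divide_distrib)
qed

lemma wirt_cnj:
  assumes "f differentiable (at z)"
  shows "wirt s i (\<lambda>w. cnj (f w)) z = cnj (wirt (cnj s) i f z)"
  by (subst wirt_eq[OF has_derivative_cnj[OF assms[unfolded frechet_derivative_works]]])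
    (simp add: wirt_def)

text \<open>Both sides are the same linear combination of real second derivatives, up to the order
  of the two directions.\<close>

lemma wirt_commute:
  assumes S: "open S" "z \<in> S" and f: "Ck_on 2 S f"
  shows "wirt s i (wirt t j f) z = wirt t j (wirt s i f) z"
proof -
  let ?D2 = "\<lambda>u. frechet_derivative (\<lambda>y. frechet_derivative f (at y) u) (at z)"
  have D: "((\<lambda>y. frechet_derivative f (at y) u) has_derivative ?D2 u) (at z)" for u
    using f S by (simp add: numeral_2_eq_2 frechet_derivative_works)
  have "(wirt t j f has_derivative (\<lambda>h. (?D2 (axis j 1) h + t * ?D2 (axis j \<i>) h) / 2)) (at z)" for t j
    unfolding wirt_def[abs_def] by (auto intro!: derivative_eq_intros D)
  note D = wirt_eq[OF this]
  have sym: "?D2 (axis j a) (axis i b) = ?D2 (axis i b) (axis j a)" for a b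
    by (rule second_derivative_symmetric[OF S f])
  show ?thesis
    unfolding D sym by (simp add: field_simps)
qed

lemma Ck_on_2_differentiable:
  assumes "Ck_on 2 S f" "z \<in> S"
  shows "f differentiable (at z)" "wirt s i f differentiable (at z)"
proof -
  have d: "(\<lambda>y. frechet_derivative f (at y) u) differentiable (at z)" for u
    using assms by (simp add: numeral_2_eq_2)
  show "wirt s i f differentiable (at z)"
    unfolding wirt_def[abs_def] divide_inverse
    by (intro differentiable_mult differentiable_add differentiable_const d)
  show "f differentiable (at z)"
    using assms by (simp add: numeral_2_eq_2)
qed

section \<open>Differentiation of matrix-valued functions and of the inverse matrix\<close>

definition mat_differentiable :: "'n matfield \<Rightarrow> complex^'n \<Rightarrow> bool" where
  "mat_differentiable M z \<longleftrightarrow> (\<forall>a b. (\<lambda>w. M w $ a $ b) differentiable (at z))"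

definition mwirt :: "complex \<Rightarrow> 'n \<Rightarrow> 'n::finite matfield \<Rightarrow> 'n matfield" where
  "mwirt s i M z = (\<chi> a b. wirt s i (\<lambda>w. M w $ a $ b) z)"

lemma mwirt_nth: "mwirt s i M z $ a $ b = wirt s i (\<lambda>w. M w $ a $ b) z"
  by (simp add: mwirt_def)

lemma mat_differentiable_add: "mat_differentiable M z \<Longrightarrow> mat_differentiable K z \<Longrightarrow> mat_differentiable (\<lambda>w. M w + K w) z"
  and mat_differentiable_diff: "mat_differentiable M z \<Longrightarrow> mat_differentiable K z \<Longrightarrow> mat_differentiable (\<lambda>w. M w - K w) z"
  and mat_differentiable_mult: "mat_differentiable M z \<Longrightarrow> mat_differentiable K z \<Longrightarrow> mat_differentiable (\<lambda>w. M w ** K w) z"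
  by (auto simp: mat_differentiable_def matrix_matrix_mult_def)

lemma mwirt_cong:
  assumes "open S" "z \<in> S" "\<And>w. w \<in> S \<Longrightarrow> M w = K w"
  shows "mwirt s i M z = mwirt s i K z"
  unfolding mwirt_def using assms(3) by (auto simp: vec_eq_iff intro!: wirt_cong[OF assms(1,2)])

lemma mat_differentiable_cong:
  assumes "open S" "z \<in> S" "\<And>w. w \<in> S \<Longrightarrow> M w = K w" "mat_differentiable K z"
  shows "mat_differentiable M z"
  unfolding mat_differentiable_def
proof (intro allI)
  fix a b
  obtain D where "((\<lambda>w. K w $ a $ b) has_derivative D) (at z)"
    using assms(4) unfolding mat_differentiable_def differentiable_def by blast
  from has_derivative_transform_within_open[OF this assms(1,2), of "\<lambda>w. M w $ a $ b"] assms(3)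
  show "(\<lambda>w. M w $ a $ b) differentiable (at z)"
    unfolding differentiable_def by auto
qed

lemma mwirt_add:
  assumes "mat_differentiable M z" "mat_differentiable K z"
  shows "mwirt s i (\<lambda>w. M w + K w) z = mwirt s i M z + mwirt s i K z"
  using assms by (simp add: vec_eq_iff mwirt_def mat_differentiable_def wirt_add)

lemma mwirt_diff:
  assumes "mat_differentiable M z" "mat_differentiable K z"
  shows "mwirt s i (\<lambda>w. M w - K w) z = mwirt s i M z - mwirt s i K z"
  using assms by (simp add: vec_eq_iff mwirt_def mat_differentiable_def wirt_diff)

lemma mwirt_mult:
  assumes "mat_differentiable M z" "mat_differentiable K z"
  shows "mwirt s i (\<lambda>w. M w ** K w) z = mwirt s i M z ** K z + M z ** mwirt s i K z"
  using assms
  by (simp add: vec_eq_iff mwirt_def mat_differentiable_def matrix_matrix_mult_def wirt_sum wirt_mult sum.distrib)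

lemma wirt_trace:
  assumes "mat_differentiable M z"
  shows "wirt s i (\<lambda>w. trace (M w)) z = trace (mwirt s i M z)"
  using assms by (simp add: trace_def mwirt_def mat_differentiable_def wirt_sum)

lemma differentiable_prod:
  fixes f :: "'i \<Rightarrow> 'a::real_normed_vector \<Rightarrow> complex"
  assumes "\<And>i. i \<in> I \<Longrightarrow> f i differentiable (at z)"
  shows "(\<lambda>w. \<Prod>i\<in>I. f i w) differentiable (at z)"
  unfolding differentiable_def
  by (rule exI, rule has_derivative_prod) (rule assms[unfolded frechet_derivative_works])

lemma differentiable_det:
  assumes "mat_differentiable M z"
  shows "(\<lambda>w. det (M w)) differentiable (at z)"
  using assms unfolding det_def mat_differentiable_def
  by (auto intro!: differentiable_sum differentiable_mult differentiable_prod)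

lemma
  fixes A :: "complex^'n^'n"
  assumes "invertible A"
  shows matrix_inv_right: "A ** matrix_inv A = mat 1" and matrix_inv_left: "matrix_inv A ** A = mat 1"
  using someI_ex[OF assms[unfolded invertible_def]] by (simp_all add: matrix_inv_def)

text \<open>Cramer's rule, applied to the equation whose solution is column \<open>b\<close> of the
  inverse. It exhibits the entries of the inverse as rational functions, which makes them
  differentiable.\<close>

lemma matrix_inv_nth_cramer:
  fixes A :: "complex^'n^'n"
  assumes "det A \<noteq> 0"
  shows "matrix_inv A $ a $ b = det (\<chi> i j. if j = a then axis b 1 $ i else A $ i $ j) / det A"
proof -
  have "A ** matrix_inv A = mat 1"
    using assms by (simp add: invertible_det_nz matrix_inv_right)
  then have "A *v (matrix_inv A *v axis b 1) = axis b 1"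
    by (simp add: matrix_vector_mul_assoc)
  then have "(matrix_inv A *v axis b 1) $ a = det (\<chi> i j. if j = a then axis b 1 $ i else A $ i $ j) / det A"
    unfolding cramer[OF assms] by simp
  then show ?thesis
    by (simp add: matrix_vector_mult_def axis_def if_distrib[of "\<lambda>x. _ * x"] cong: if_cong)
qed

lemma mat_differentiable_inv:
  assumes "open S" "z \<in> S" and inv: "\<And>w. w \<in> S \<Longrightarrow> invertible (M w)" and M: "mat_differentiable M z"
  shows "mat_differentiable (\<lambda>w. matrix_inv (M w)) z"
proof (rule mat_differentiable_cong[OF assms(1,2)])
  let ?A = "\<lambda>a b w. (\<chi> i j. if j = a then axis b 1 $ i else M w $ i $ j) :: complex^'a^'a"
  show "matrix_inv (M w) = (\<chi> a b. det (?A a b w) / det (M w))" if "w \<in> S" for w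
    using inv[OF that] by (simp add: vec_eq_iff invertible_det_nz matrix_inv_nth_cramer)
  have "mat_differentiable (?A a b) z" for a b
    unfolding mat_differentiable_def
  proof (intro allI)
    fix i j
    show "(\<lambda>w. ?A a b w $ i $ j) differentiable (at z)"
      using M by (cases "j = a") (simp_all add: mat_differentiable_def)
  qed
  then show "mat_differentiable (\<lambda>w. \<chi> a b. det (?A a b w) / det (M w)) z"
    using M inv[OF assms(2)] unfolding mat_differentiable_def[of "\<lambda>w. \<chi> a b. det (?A a b w) / det (M w)"]
    by (auto simp: invertible_det_nz intro!: differentiable_divide differentiable_det)
qed

text \<open>Differentiate \<open>M w ** matrix_inv (M w) = mat 1\<close>, which holds near
  \<open>z\<close>, and solve for the derivative of the inverse.\<close>

lemma mwirt_inv: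
  assumes "open S" "z \<in> S" and inv: "\<And>w. w \<in> S \<Longrightarrow> invertible (M w)" and M: "mat_differentiable M z"
  shows "mwirt s i (\<lambda>w. matrix_inv (M w)) z = - (matrix_inv (M z) ** mwirt s i M z ** matrix_inv (M z))"
proof -
  let ?N = "\<lambda>w. matrix_inv (M w)"
  have "mwirt s i (\<lambda>w. M w ** ?N w) z = mwirt s i (\<lambda>w. mat 1) z"
    using inv by (intro mwirt_cong[OF assms(1,2)]) (rule matrix_inv_right)
  also have "\<dots> = 0"
    by (simp add: mwirt_def vec_eq_iff wirt_const)
  finally have "mwirt s i M z ** ?N z + M z ** mwirt s i ?N z = 0"
    by (simp add: mwirt_mult M mat_differentiable_inv[OF assms])
  then have "?N z ** (M z ** mwirt s i ?N z) = ?N z ** (- (mwirt s i M z ** ?N z))"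
    by (metis add_eq_0_iff)
  then show ?thesis
    using matrix_inv_left[OF inv[OF assms(2)]] by (simp add: matrix_mul_assoc matrix_neg_right)
qed

section \<open>Closedness of a (1,1)-form in components\<close>

lemma form11_frechet:
  assumes "mat_differentiable r z"
  shows "frechet_derivative (\<lambda>x. form11 r x v w) (at z) u
    = \<i> * (\<Sum>i\<in>UNIV. \<Sum>j\<in>UNIV. frechet_derivative (\<lambda>x. r x $ i $ j) (at z) u * (v $ i * cnj (w $ j) - w $ i * cnj (v $ j)))"
proof -
  have D: "((\<lambda>x. r x $ i $ j) has_derivative frechet_derivative (\<lambda>x. r x $ i $ j) (at z)) (at z)" for i j
    using assms by (simp add: mat_differentiable_def frechet_derivative_works)
  have "((\<lambda>x. form11 r x v w) has_derivative (\<lambda>u. \<i> * (\<Sum>i\<in>UNIV. \<Sum>j\<in>UNIV.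
      frechet_derivative (\<lambda>x. r x $ i $ j) (at z) u * (v $ i * cnj (w $ j) - w $ i * cnj (v $ j))))) (at z)"
    unfolding form11_def by (intro has_derivative_mult_right has_derivative_sum has_derivative_mult_left D)
  from fun_cong[OF frechet_derivative_at[OF this, symmetric]] show ?thesis .
qed

lemma sum_axis_form:
  fixes D :: "'n::finite \<Rightarrow> 'n \<Rightarrow> complex"
  shows "(\<Sum>i\<in>UNIV. \<Sum>j\<in>UNIV. D i j * (axis k b $ i * cnj (axis m c $ j) - axis m c $ i * cnj (axis k b $ j)))
    = D k m * b * cnj c - D m k * c * cnj b"
proof -
  have "(\<Sum>i\<in>UNIV. \<Sum>j\<in>UNIV. D i j * (axis p a $ i * cnj (axis q d $ j))) = D p q * a * cnj d" for p q a d
    by (simp add: axis_def if_distrib[of cnj] if_distrib[of "\<lambda>x. _ * x"] if_distrib[of "\<lambda>x. x * _"] cong: if_cong)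
  then show ?thesis
    by (simp add: right_diff_distrib sum_subtractf)
qed

text \<open>Closedness is stated with real tangent vectors, so the two types in
  \<open>d\<rho>\<close> have to be separated. Up to the factor \<open>\<i>\<close>,
  \<open>e a b c\<close> is \<open>d\<rho>\<close> on three coordinate vectors scaled by
  \<open>a\<close>, \<open>b\<close>, \<open>c\<close>.\<close>

lemma closed_form11_symmetric:
  assumes r: "mat_differentiable r z" and closed: "\<And>u v w. ext_deriv2 (form11 r) z u v w = 0"
  shows "dz i (\<lambda>w. r w $ k $ m) z = dz k (\<lambda>w. r w $ i $ m) z"
    and "dzbar i (\<lambda>w. r w $ k $ m) z = dzbar m (\<lambda>w. r w $ k $ i) z"
proof -
  define D where "D a b u = frechet_derivative (\<lambda>w. r w $ a $ b) (at z) u" for a b u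
  define e where "e a b c = D k m (axis i a) * b * cnj c - D m k (axis i a) * c * cnj b
      - (D i m (axis k b) * a * cnj c - D m i (axis k b) * c * cnj a)
      + (D i k (axis m c) * a * cnj b - D k i (axis m c) * b * cnj a)" for a b c :: complex
  have e: "e a b c = 0" for a b c
  proof -
    have "\<i> * e a b c = 0"
      using closed[of "axis i a" "axis k b" "axis m c"]
      unfolding ext_deriv2_def form11_frechet[OF r] D_def[symmetric] sum_axis_form e_def
      by (simp only: distrib_left right_diff_distrib)
    then show ?thesis by simp
  qed
  have dz_D: "dz p (\<lambda>w. r w $ a $ b) z = (D a b (axis p 1) - \<i> * D a b (axis p \<i>)) / 2"
    and dzbar_D: "dzbar p (\<lambda>w. r w $ a $ b) z = (D a b (axis p 1) + \<i> * D a b (axis p \<i>)) / 2" for p a b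
    by (simp_all add: dz_def dzbar_def D_def)
  \<comment> \<open>Averaging \<open>e\<close> against characters in \<open>a, b, c \<in> {1, \<i>}\<close> extracts the component of \<open>d\<rho>\<close> of type (2,1)
    here, and of type (1,2) below.\<close>
  have "0 = (e 1 1 1 + \<i> * e 1 1 \<i>) - \<i> * (e 1 \<i> 1 + \<i> * e 1 \<i> \<i>)
      - \<i> * (e \<i> 1 1 + \<i> * e \<i> 1 \<i> - \<i> * (e \<i> \<i> 1 + \<i> * e \<i> \<i> \<i>))"
    unfolding e by simp
  \<comment> \<open>Each index contributes a factor 2: the derivative index through the definition
    of \<open>dz\<close>, the other two through \<open>1 - \<i> * \<i> = 2\<close>. The unwanted
    terms carry a factor \<open>1 + \<i> * \<i> = 0\<close>.\<close>
  also have "\<dots> = 8 * (dz i (\<lambda>w. r w $ k $ m) z - dz k (\<lambda>w. r w $ i $ m) z)"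
    unfolding dz_D e_def by (simp add: algebra_simps add_divide_distrib diff_divide_distrib)
  finally show "dz i (\<lambda>w. r w $ k $ m) z = dz k (\<lambda>w. r w $ i $ m) z" by simp
  have "0 = (e 1 1 1 + \<i> * e 1 1 \<i>) - \<i> * (e 1 \<i> 1 + \<i> * e 1 \<i> \<i>)
      + \<i> * (e \<i> 1 1 + \<i> * e \<i> 1 \<i> - \<i> * (e \<i> \<i> 1 + \<i> * e \<i> \<i> \<i>))"
    unfolding e by simp
  also have "\<dots> = 8 * (dzbar i (\<lambda>w. r w $ k $ m) z - dzbar m (\<lambda>w. r w $ k $ i) z)"
    unfolding dzbar_D e_def by (simp add: algebra_simps add_divide_distrib diff_divide_distrib)
  finally show "dzbar i (\<lambda>w. r w $ k $ m) z = dzbar m (\<lambda>w. r w $ k $ i) z" by simp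
qed

section \<open>Tensor contractions as traces and matrix entries\<close>

lemma trace11_eq_trace: "trace11 g r z = trace (r z ** matrix_inv (g z))"
  by (simp add: trace11_def trace_mult_eq_sum ginv_def mult.commute)

lemma norm2_form_eq_trace:
  "norm2_form g r z = trace ((r z ** matrix_inv (g z)) ** (r z ** matrix_inv (g z)))" (is "_ = ?R")
proof -
  have "?R = (\<Sum>k\<in>UNIV. \<Sum>p\<in>UNIV. \<Sum>q\<in>UNIV. \<Sum>l\<in>UNIV.
      r z $ k $ q * matrix_inv (g z) $ q $ p * (r z $ p $ l * matrix_inv (g z) $ l $ k))"
    by (simp add: trace_mult_eq_sum) (simp add: matrix_matrix_mult_def sum_product)
  also have "\<dots> = norm2_form g r z"
    unfolding norm2_form_def sum.cartesian_product
    by (rule sum.reindex_bij_witness[of _ "\<lambda>(p,q,k,l). (k,p,q,l)" "\<lambda>(k,p,q,l). (p,q,k,l)"])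
      (auto simp: ginv_def mult_ac)
  finally show ?thesis by simp
qed

lemma raise11_eq: "raise11 g r z i j = (matrix_inv (g z) ** (r z ** matrix_inv (g z))) $ j $ i"
  by (simp add: raise11_def ginv_def matrix_matrix_mult_def sum_distrib_left mult_ac)

lemma square_form_eq: "square_form g r z = r z ** matrix_inv (g z) ** r z"
  unfolding square_form_def vec_eq_iff matrix_matrix_mult_def
  by (simp add: ginv_def sum_distrib_left sum_distrib_right mult_ac)

lemma Gam_eq: "Gam g z i k l = (mwirt (- \<i>) i g z ** matrix_inv (g z)) $ k $ l"
  by (simp add: Gam_def ginv_def matrix_matrix_mult_def mwirt_nth dz_eq_wirt mult.commute)

text \<open>Moves the two inverse metrics from the contravariant factors onto \<open>Q\<close>,
  where they raise its barred indices.\<close>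

lemma sum_contract_raised:
  fixes N X Y :: "complex^'n^'n"
  shows "(\<Sum>i\<in>UNIV. \<Sum>j\<in>UNIV. \<Sum>k\<in>UNIV. \<Sum>l\<in>UNIV. Q i j k l * ((N ** X) $ j $ i * (N ** Y) $ l $ k))
    = (\<Sum>i\<in>UNIV. \<Sum>p\<in>UNIV. \<Sum>k\<in>UNIV. \<Sum>s\<in>UNIV.
        (\<Sum>j\<in>UNIV. \<Sum>l\<in>UNIV. N $ j $ p * N $ l $ s * Q i j k l) * (X $ p $ i * Y $ s $ k))"
proof -
  have Q: "Q i j k l * ((N ** X) $ j $ i * (N ** Y) $ l $ k)
      = (\<Sum>p\<in>UNIV. \<Sum>s\<in>UNIV. N $ j $ p * N $ l $ s * Q i j k l * (X $ p $ i * Y $ s $ k))" for i j k l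
    unfolding matrix_matrix_mult_def
    by (simp add: sum_product sum_distrib_left mult_ac) (rule sum.swap)
  show ?thesis
    unfolding Q sum_distrib_right unfolding sum.cartesian_product
    by (rule sum.reindex_bij_witness[of _ "\<lambda>(i,p,k,s,j,l). (i,j,k,l,p,s)" "\<lambda>(i,j,k,l,p,s). (i,p,k,s,j,l)"])
      (auto simp: mult_ac)
qed

subsection \<open>Hermitian geometry in one chart\<close>

text \<open>The data of one chart: \<open>G\<close> and \<open>R\<close> hold the components of the
  metric and of \<open>\<rho>\<close>, and \<open>c\<close> is the constant trace.
  \<open>Ck_on 2\<close> is the regularity at which mixed second derivatives commute.\<close>

locale hermitian_chart =
  fixes S :: "(complex^'n) set" and G R :: "'n::finite matfield" and c :: complex
  assumes open_S: "open S"
    and C2_G: "Ck_on 2 S (\<lambda>z. G z $ a $ b)" and C2_R: "Ck_on 2 S (\<lambda>z. R z $ a $ b)"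
    and herm_G: "z \<in> S \<Longrightarrow> hermitian_mat (G z)" and pos_G: "z \<in> S \<Longrightarrow> pos_def_mat (G z)"
    and herm_R: "z \<in> S \<Longrightarrow> hermitian_mat (R z)"
    and closed_R: "z \<in> S \<Longrightarrow> ext_deriv2 (form11 R) z u v w = 0"
    and trace_R: "z \<in> S \<Longrightarrow> trace11 G R z = c"
begin

definition "N z = matrix_inv (G z)"
definition "P z = R z ** N z"

lemma inv_G: "z \<in> S \<Longrightarrow> invertible (G z)"
  using pos_G by (rule pos_def_mat_invertible)

lemma G_N: "z \<in> S \<Longrightarrow> G z ** N z = mat 1" and N_G: "z \<in> S \<Longrightarrow> N z ** G z = mat 1"
  unfolding N_def by (simp_all add: inv_G matrix_inv_right matrix_inv_left)

lemma diff_G: "z \<in> S \<Longrightarrow> mat_differentiable G z" and diff_R: "z \<in> S \<Longrightarrow> mat_differentiable R z"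
  by (simp_all add: mat_differentiable_def Ck_on_2_differentiable[OF C2_G] Ck_on_2_differentiable[OF C2_R])

lemma diff_N: "z \<in> S \<Longrightarrow> mat_differentiable N z"
  unfolding N_def[abs_def] by (rule mat_differentiable_inv[OF open_S _ inv_G diff_G])

lemma diff_P: "z \<in> S \<Longrightarrow> mat_differentiable P z"
  unfolding P_def[abs_def] by (intro mat_differentiable_mult diff_R diff_N)

lemma diff_DG: "z \<in> S \<Longrightarrow> mat_differentiable (mwirt s i G) z"
  and diff_DR: "z \<in> S \<Longrightarrow> mat_differentiable (mwirt s i R) z"
  by (simp_all add: mat_differentiable_def mwirt_nth Ck_on_2_differentiable[OF C2_G] Ck_on_2_differentiable[OF C2_R])

lemma mwirt_N: "z \<in> S \<Longrightarrow> mwirt s i N z = - (N z ** mwirt s i G z ** N z)"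
  unfolding N_def[abs_def] by (rule mwirt_inv[OF open_S _ inv_G diff_G])

lemma mwirt_P:
  assumes "z \<in> S"
  shows "mwirt s i P z = (mwirt s i R z - P z ** mwirt s i G z) ** N z"
proof -
  have "mwirt s i P z = mwirt s i R z ** N z + R z ** mwirt s i N z"
    unfolding P_def[abs_def] using assms by (intro mwirt_mult diff_R diff_N)
  then show ?thesis
    using assms by (simp add: mwirt_N P_def matrix_expand matrix_mul_assoc)
qed

lemma mwirt_mwirt_P:
  assumes z: "z \<in> S"
  shows "mwirt s i (mwirt t j P) z
    = (mwirt s i (mwirt t j R) z - mwirt s i P z ** mwirt t j G z - P z ** mwirt s i (mwirt t j G) z) ** N z
      - (mwirt t j R z - P z ** mwirt t j G z) ** N z ** mwirt s i G z ** N z"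
proof -
  note diffs = diff_R diff_N diff_P diff_DG diff_DR mat_differentiable_mult mat_differentiable_diff
  have "mwirt s i (mwirt t j P) z = mwirt s i (\<lambda>z. (mwirt t j R z - P z ** mwirt t j G z) ** N z) z"
    using z by (intro mwirt_cong[OF open_S]) (simp_all add: mwirt_P)
  also have "\<dots> = mwirt s i (\<lambda>z. mwirt t j R z - P z ** mwirt t j G z) z ** N z
      + (mwirt t j R z - P z ** mwirt t j G z) ** mwirt s i N z"
    using z by (intro mwirt_mult diffs)
  also have "mwirt s i (\<lambda>z. mwirt t j R z - P z ** mwirt t j G z) z
      = mwirt s i (mwirt t j R) z - (mwirt s i P z ** mwirt t j G z + P z ** mwirt s i (mwirt t j G) z)"
    using z by (simp add: mwirt_diff mwirt_mult diffs)
  finally show ?thesis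
    using z by (simp add: mwirt_N matrix_expand matrix_mul_assoc)
qed

lemma diff_DP: "z \<in> S \<Longrightarrow> mat_differentiable (mwirt s i P) z"
  by (rule mat_differentiable_cong[OF open_S _ mwirt_P])
    (auto intro!: diff_R diff_N diff_P diff_DG diff_DR mat_differentiable_mult mat_differentiable_diff)

text \<open>This is where the constancy of the trace enters: \<open>trace (P w)\<close> equals
  \<open>c\<close> on all of the open set, so its derivatives vanish.\<close>

lemma trace_mwirt_mwirt_P:
  assumes z: "z \<in> S"
  shows "trace (mwirt s i (mwirt t j P) z) = 0"
proof -
  have c: "trace (P w) = c" if "w \<in> S" for w
    using trace_R[OF that] by (simp add: trace11_eq_trace P_def N_def)
  have "trace (mwirt t j P w) = 0" if "w \<in> S" for w
    using wirt_trace[OF diff_P[OF that], of t j] wirt_cong[OF open_S that c, where s = t and i = j] by (simp add: wirt_const)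
  then have "wirt s i (\<lambda>w. trace (mwirt t j P w)) z = 0"
    using wirt_cong[OF open_S z, of "\<lambda>w. trace (mwirt t j P w)" "\<lambda>w. 0"] by (simp add: wirt_const)
  then show ?thesis
    by (simp add: wirt_trace diff_DP[OF z])
qed

lemma wirt_wirt_norm2:
  assumes z: "z \<in> S"
  shows "wirt s i (wirt t j (norm2_form G R)) z
    = 2 * trace (mwirt s i P z ** mwirt t j P z) + 2 * trace (P z ** mwirt s i (mwirt t j P) z)"
proof -
  have n: "norm2_form G R = (\<lambda>w. trace (P w ** P w))"
    by (simp add: fun_eq_iff norm2_form_eq_trace P_def N_def)
  have "wirt t j (norm2_form G R) w = trace (P w ** mwirt t j P w) + trace (P w ** mwirt t j P w)" if "w \<in> S" for w
    unfolding n by (simp add: wirt_trace mat_differentiable_mult diff_P that mwirt_mult trace_add trace_mul_sym[of "mwirt t j P w"])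
  then have "wirt s i (wirt t j (norm2_form G R)) z
      = wirt s i (\<lambda>w. trace (P w ** mwirt t j P w + P w ** mwirt t j P w)) z"
    by (intro wirt_cong[OF open_S z]) (simp only: trace_add)
  also have "\<dots> = trace (mwirt s i (\<lambda>w. P w ** mwirt t j P w + P w ** mwirt t j P w) z)"
    using z by (intro wirt_trace mat_differentiable_add mat_differentiable_mult diff_P diff_DP)
  also have "mwirt s i (\<lambda>w. P w ** mwirt t j P w + P w ** mwirt t j P w) z
     = mwirt s i (\<lambda>w. P w ** mwirt t j P w) z + mwirt s i (\<lambda>w. P w ** mwirt t j P w) z"
    using z by (intro mwirt_add mat_differentiable_mult diff_P diff_DP)
  also have "mwirt s i (\<lambda>w. P w ** mwirt t j P w) z = mwirt s i P z ** mwirt t j P z + P z ** mwirt s i (mwirt t j P) z"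
    using z by (intro mwirt_mult diff_P diff_DP)
  finally show ?thesis
    by (simp only: trace_add) simp
qed

text \<open>Conjugation swaps the two kinds of Wirtinger derivative, and on a Hermitian matrix it
  swaps the two indices.\<close>

lemma cnj_dz:
  assumes "z \<in> S"
  shows "cnj (wirt (- \<i>) i (\<lambda>w. G w $ a $ b) z) = wirt \<i> i (\<lambda>w. G w $ b $ a) z"
    and "cnj (wirt (- \<i>) i (\<lambda>w. R w $ a $ b) z) = wirt \<i> i (\<lambda>w. R w $ b $ a) z"
proof -
  have "wirt \<i> i (\<lambda>w. M w $ b $ a) z = cnj (wirt (- \<i>) i (\<lambda>w. M w $ a $ b) z)"
    if "mat_differentiable M z" "\<And>w. w \<in> S \<Longrightarrow> hermitian_mat (M w)" for M
  proof -
    have "wirt \<i> i (\<lambda>w. M w $ b $ a) z = wirt \<i> i (\<lambda>w. cnj (M w $ a $ b)) z"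
      using that(2) by (intro wirt_cong[OF open_S assms]) (simp add: hermitian_mat_def)
    then show ?thesis
      using that(1) by (simp add: wirt_cnj mat_differentiable_def)
  qed
  then show "cnj (wirt (- \<i>) i (\<lambda>w. G w $ a $ b) z) = wirt \<i> i (\<lambda>w. G w $ b $ a) z"
    "cnj (wirt (- \<i>) i (\<lambda>w. R w $ a $ b) z) = wirt \<i> i (\<lambda>w. R w $ b $ a) z"
    using assms by (simp_all add: diff_G diff_R herm_G herm_R)
qed

lemma cnj_N: "z \<in> S \<Longrightarrow> cnj (N z $ a $ b) = N z $ b $ a"
  using cnj_ginv[of G z b a] by (simp add: herm_G pos_G ginv_def N_def)

lemma cnj_R: "z \<in> S \<Longrightarrow> cnj (R z $ a $ b) = R z $ b $ a"
  using herm_R[of z] by (simp add: hermitian_mat_def)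

lemma dz_R_symmetric:
  assumes "z \<in> S"
  shows "wirt (- \<i>) i (\<lambda>w. R w $ k $ m) z = wirt (- \<i>) k (\<lambda>w. R w $ i $ m) z"
    and "wirt \<i> i (\<lambda>w. R w $ k $ m) z = wirt \<i> m (\<lambda>w. R w $ k $ i) z"
  using closed_form11_symmetric[OF diff_R[OF assms] closed_R[OF assms]]
  by (simp_all only: dz_eq_wirt dzbar_eq_wirt)

lemma dz_dzbar_R_symmetric:
  assumes z: "z \<in> S"
  shows "wirt (- \<i>) i (wirt \<i> q (\<lambda>w. R w $ k $ m)) z = wirt (- \<i>) k (wirt \<i> q (\<lambda>w. R w $ i $ m)) z"
    and "wirt (- \<i>) i (wirt \<i> q (\<lambda>w. R w $ k $ m)) z = wirt (- \<i>) i (wirt \<i> m (\<lambda>w. R w $ k $ q)) z"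
proof -
  show "wirt (- \<i>) i (wirt \<i> q (\<lambda>w. R w $ k $ m)) z = wirt (- \<i>) k (wirt \<i> q (\<lambda>w. R w $ i $ m)) z"
    \<comment> \<open>Closedness exchanges a derivative index with the matrix index of the same
      type, so the holomorphic derivative has to become the inner one.\<close>
    unfolding wirt_commute[OF open_S z C2_R, of "- \<i>" _ \<i>]
    by (intro wirt_cong[OF open_S z] dz_R_symmetric)
  show "wirt (- \<i>) i (wirt \<i> q (\<lambda>w. R w $ k $ m)) z = wirt (- \<i>) i (wirt \<i> m (\<lambda>w. R w $ k $ q)) z"
    by (intro wirt_cong[OF open_S z] dz_R_symmetric)
qed

text \<open>\<open>dG z i\<close> is the matrix of the Chern coefficients \<open>\<Gamma>\<close>
  with first lower index \<open>i\<close>. In the barred versions the derivative index is raised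
  too. A prime exchanges the derivative index with the row index for \<open>dG\<close>, and with the
  column index, itself a raised barred index, for \<open>dbarG\<close>.\<close>

definition "dG z i = mwirt (- \<i>) i G z ** N z"
definition "dR z i = mwirt (- \<i>) i R z ** N z"
definition "dbarG z = contract (N z) (\<lambda>q. mwirt \<i> q G z ** N z)"
definition "dbarR z = contract (N z) (\<lambda>q. mwirt \<i> q R z ** N z)"
definition "dG' z i = (\<chi> k l. dG z k $ i $ l)"
definition "dbarG' z i = (\<chi> k l. dbarG z l $ k $ i)"
definition "ddG z i = contract (N z) (\<lambda>q. mwirt (- \<i>) i (mwirt \<i> q G) z ** N z)"
definition "ddR z i = contract (N z) (\<lambda>q. mwirt (- \<i>) i (mwirt \<i> q R) z ** N z)"
definition "V z i = dR z i - P z ** dG z i + P z ** dG' z i - dG' z i ** P z"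
definition "W z i = dbarR z i - dbarG z i ** P z - P z ** dbarG' z i + dbarG' z i ** P z"
text \<open>\<open>V\<close> and \<open>W\<close> are \<open>\<nabla>\<^sup>+\<rho>\<close> and its conjugate, \<open>Qhat\<close> is \<open>Q\<close>, all with barred indices raised.\<close>

definition "Qhat z i j k l = (dG z i ** dbarG z j - ddG z i j) $ k $ l
  - (\<Sum>p\<in>UNIV. (dG' z p - dG z p) $ k $ j * (dbarG' z p - dbarG z p) $ i $ l)"

lemma dz_P: "z \<in> S \<Longrightarrow> mwirt (- \<i>) i P z = dR z i - P z ** dG z i"
  by (simp add: mwirt_P dR_def dG_def matrix_expand matrix_mul_assoc)

lemma dzbar_P: "z \<in> S \<Longrightarrow> contract (N z) (\<lambda>q. mwirt \<i> q P z) i = dbarR z i - P z ** dbarG z i"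
  by (simp add: mwirt_P dbarR_def dbarG_def matrix_expand contract_diff contract_mult_left matrix_mul_assoc)

lemma dz_dzbar_P:
  assumes "z \<in> S"
  shows "contract (N z) (\<lambda>q. mwirt (- \<i>) i (mwirt \<i> q P) z) j
    = ddR z i j - (dR z i - P z ** dG z i) ** dbarG z j - P z ** ddG z i j - (dbarR z j - P z ** dbarG z j) ** dG z i"
  using assms
  by (simp add: mwirt_mwirt_P dz_P)
    (simp add: matrix_expand ddR_def ddG_def dbarR_def dbarG_def dG_def contract_diff contract_mult_left
      contract_mult_right matrix_mul_assoc)

text \<open>Arranged as twice the left side of \<open>bochner_identity_algebraic\<close>, with
  \<open>dG\<close>, \<open>dR\<close>, \<open>dbarG\<close>, \<open>dbarR\<close>,
  \<open>ddG\<close>, \<open>ddR\<close> in the roles of \<open>\<alpha>\<close>,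
  \<open>\<epsilon>\<close>, \<open>\<beta>\<close>, \<open>\<eta>\<close>, \<open>B\<close>,
  \<open>F\<close>.\<close>

lemma laplacian_norm2:
  assumes z: "z \<in> S"
  shows "(\<Sum>i\<in>UNIV. \<Sum>j\<in>UNIV. ginv G z i j * dz i (dzbar j (norm2_form G R)) z)
    = 2 * (\<Sum>i\<in>UNIV. trace ((dR z i - P z ** dG z i) ** (dbarR z i - P z ** dbarG z i))
      + trace (P z ** (ddR z i i - dbarR z i ** dG z i - dR z i ** dbarG z i
          + P z ** (dG z i ** dbarG z i + dbarG z i ** dG z i - ddG z i i))))"
proof -
  have row: "(\<Sum>j\<in>UNIV. ginv G z i j * dz i (dzbar j (norm2_form G R)) z)
      = 2 * (trace (mwirt (- \<i>) i P z ** contract (N z) (\<lambda>q. mwirt \<i> q P z) i)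
        + trace (P z ** contract (N z) (\<lambda>q. mwirt (- \<i>) i (mwirt \<i> q P) z) i))" for i
    unfolding contract_mult_left trace_contract dz_eq_wirt dzbar_eq_wirt wirt_wirt_norm2[OF z]
    by (simp add: ginv_def N_def[symmetric] distrib_left sum.distrib sum_distrib_left mult_ac)
  show ?thesis
    unfolding row dz_P[OF z] dzbar_P[OF z] dz_dzbar_P[OF z]
    by (simp add: sum_distrib_left sum.distrib matrix_expand matrix_mul_assoc algebra_simps)
qed

section \<open>Torsion, the Bismut derivative and its norm\<close>

lemma dG_G: "z \<in> S \<Longrightarrow> dG z i ** G z = mwirt (- \<i>) i G z"
  by (simp add: dG_def matrix_mul_assoc[symmetric] N_G)

lemma Gam_eq_dG: "Gam G z i k l = dG z i $ k $ l"
  by (simp add: Gam_eq dG_def N_def)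

lemma Tor_low_eq:
  assumes "z \<in> S"
  shows "Tor_low G z i j k = mwirt (- \<i>) i G z $ j $ k - mwirt (- \<i>) j G z $ i $ k"
  unfolding Tor_low_def Tor_def Gam_eq_dG dG_G[OF assms, symmetric]
  by (simp add: matrix_matrix_mult_def right_diff_distrib sum_subtractf mult.commute)

definition "torsion z i = (\<chi> q m. Tor_low G z i q m)"
definition "nabla z i = (\<chi> k m. nabla_plus G R z i k m)"

lemma torsion_N: "z \<in> S \<Longrightarrow> torsion z i ** N z = dG z i - dG' z i"
  by (simp add: vec_eq_iff torsion_def Tor_low_eq dG'_def dG_def matrix_matrix_mult_def
      left_diff_distrib sum_subtractf)

text \<open>The Bismut connection uses \<open>\<Gamma>\<close> with its lower indices exchanged,
  hence \<open>dG'\<close> rather than \<open>dG\<close>.\<close>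

lemma nabla_eq:
  assumes "z \<in> S"
  shows "nabla z i = mwirt (- \<i>) i R z - dG' z i ** R z - P z ** torsion z i"
proof -
  have "(\<Sum>q\<in>UNIV. \<Sum>p\<in>UNIV. ginv G z q p * Tor_low G z i q m * R z $ k $ p) = (P z ** torsion z i) $ k $ m" for k m
    by (simp add: P_def torsion_def matrix_matrix_mult_def ginv_def N_def sum_distrib_left sum_distrib_right mult_ac)
  then show ?thesis
    using assms
    by (simp add: vec_eq_iff nabla_def nabla_plus_explicit herm_G pos_G dz_eq_wirt mwirt_nth Gam_eq_dG dG'_def
        matrix_matrix_mult_def[of _ "R z"])
qed

lemma nabla_N:
  assumes "z \<in> S"
  shows "nabla z i ** N z = V z i"
  unfolding nabla_eq[OF assms] matrix_sub_rdistrib matrix_mul_assoc[symmetric] torsion_N[OF assms]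
  by (simp add: P_def[symmetric] V_def dR_def matrix_expand)

text \<open>This is \<open>dbarG'\<close> before its barred indices are raised.\<close>

definition "dbarG_swap z i = (\<chi> k l. mwirt \<i> l G z $ k $ i)"

lemma dbarG'_eq: "dbarG' z i = contract (N z) (\<lambda>a. dbarG_swap z a ** N z) i"
  by (simp add: vec_eq_iff dbarG'_def dbarG_def contract_def dbarG_swap_def matrix_matrix_mult_def sum_distrib_left mult_ac)
    (intro allI, subst sum.swap, simp add: mult.left_commute)

text \<open>Conjugate transposition reverses products. Since the metric and \<open>\<rho>\<close>
  are Hermitian, it sends \<open>dG' z a\<close> to \<open>N z ** dbarG_swap z a\<close> and
  \<open>P z\<close> to \<open>N z ** R z\<close>.\<close>

lemma cnj_nabla:
  assumes z: "z \<in> S"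
  shows "(\<chi> c b. cnj (nabla z a $ b $ c))
    = mwirt \<i> a R z - P z ** dbarG_swap z a - (mwirt \<i> a G z - dbarG_swap z a) ** N z ** R z"
proof -
  have 1: "cnj ((dG' z a ** R z) $ b $ c) = (P z ** dbarG_swap z a) $ c $ b" for b c
  proof -
    have "cnj (dG' z a $ b $ l) = (N z ** dbarG_swap z a) $ l $ b" for l
      by (simp add: dG'_def dG_def dbarG_swap_def matrix_matrix_mult_def mwirt_nth cnj_dz[OF z] cnj_N[OF z] mult.commute)
    then have "cnj ((dG' z a ** R z) $ b $ c) = (R z ** (N z ** dbarG_swap z a)) $ c $ b"
      by (simp add: matrix_matrix_mult_def[of "dG' z a"] matrix_matrix_mult_def[of "R z"] cnj_R[OF z] mult.commute)
    then show ?thesis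
      by (simp add: P_def matrix_mul_assoc)
  qed
  have 2: "cnj ((P z ** torsion z a) $ b $ c) = ((mwirt \<i> a G z - dbarG_swap z a) ** N z ** R z) $ c $ b" for b c
  proof -
    have "cnj (P z $ b $ q) = (N z ** R z) $ q $ b" for q
      by (simp add: P_def matrix_matrix_mult_def cnj_R[OF z] cnj_N[OF z] mult.commute)
    moreover have "cnj (torsion z a $ q $ c) = (mwirt \<i> a G z - dbarG_swap z a) $ c $ q" for q
      by (simp add: torsion_def Tor_low_eq[OF z] dbarG_swap_def mwirt_nth cnj_dz[OF z])
    ultimately have "cnj ((P z ** torsion z a) $ b $ c) = ((mwirt \<i> a G z - dbarG_swap z a) ** (N z ** R z)) $ c $ b"
      by (simp add: matrix_matrix_mult_def[of "P z"] matrix_matrix_mult_def[of "_ - _"] mult.commute)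
    then show ?thesis
      by (simp add: matrix_mul_assoc)
  qed
  show ?thesis
    unfolding nabla_eq[OF z]
    by (simp add: vec_eq_iff 1 2) (simp add: mwirt_nth cnj_dz[OF z])
qed

lemma cnj_nabla_raised:
  assumes z: "z \<in> S"
  shows "contract (N z) (\<lambda>a. (\<chi> c b. cnj (nabla z a $ b $ c)) ** N z) i = W z i"
proof -
  have raised: "(\<chi> c b. cnj (nabla z a $ b $ c)) ** N z = mwirt \<i> a R z ** N z - P z ** (dbarG_swap z a ** N z)
      - mwirt \<i> a G z ** N z ** P z + dbarG_swap z a ** N z ** P z" for a
    unfolding cnj_nabla[OF z] by (simp add: matrix_expand P_def matrix_mul_assoc)
  show ?thesis
    unfolding raised
    by (simp add: W_def contract_diff contract_add contract_mult_left[symmetric] contract_mult_right[symmetric]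
        dbarG'_eq dbarG_def[symmetric] dbarR_def[symmetric] algebra_simps)
qed

text \<open>Of the three inverse metrics in the norm, one raises the barred index of
  \<open>nabla\<close> and gives \<open>V\<close>; the other two raise the barred indices of the
  conjugate and give \<open>W\<close>.\<close>

lemma norm2_nabla_plus_eq:
  assumes z: "z \<in> S"
  shows "norm2_nabla_plus G R z = (\<Sum>i\<in>UNIV. trace (V z i ** W z i))"
proof -
  have W: "W z i $ c $ k = (\<Sum>a\<in>UNIV. \<Sum>b\<in>UNIV. N z $ a $ i * (cnj (nabla z a $ b $ c) * N z $ b $ k))" for i c k
    unfolding cnj_nabla_raised[OF z, symmetric]
    by (simp add: contract_def matrix_matrix_mult_def sum_distrib_left)
  have "(\<Sum>i\<in>UNIV. trace (V z i ** W z i)) = (\<Sum>i\<in>UNIV. \<Sum>k\<in>UNIV. \<Sum>c\<in>UNIV. \<Sum>m\<in>UNIV. \<Sum>a\<in>UNIV. \<Sum>b\<in>UNIV.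
      nabla z i $ k $ m * N z $ m $ c * (N z $ a $ i * (cnj (nabla z a $ b $ c) * N z $ b $ k)))"
    unfolding nabla_N[OF z, symmetric] trace_mult_eq_sum W
    by (simp add: matrix_matrix_mult_def sum_distrib_right) (simp add: sum_distrib_left)
  also have "\<dots> = norm2_nabla_plus G R z"
    unfolding norm2_nabla_plus_def sum.cartesian_product
    by (rule sum.reindex_bij_witness[of _ "\<lambda>(i,a,k,b,c,m). (i,k,c,m,a,b)" "\<lambda>(i,k,c,m,a,b). (i,a,k,b,c,m)"])
      (auto simp: nabla_def ginv_def N_def mult_ac)
  finally show ?thesis by simp
qed

section \<open>The curvature term \<open>Q\<close> with raised indices\<close>

lemma Curv_raised:
  assumes z: "z \<in> S"
  shows "(\<Sum>l\<in>UNIV. N z $ l $ s * Curv_low G z i j k l)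
    = (dG z i ** (mwirt \<i> j G z ** N z) - mwirt (- \<i>) i (mwirt \<i> j G) z ** N z) $ k $ s"
proof -
  have "(\<Sum>l\<in>UNIV. N z $ l $ s * Curv_low G z i j k l) = (\<Sum>l\<in>UNIV. \<Sum>m\<in>UNIV. G z $ m $ l * N z $ l $ s * Curv G z i j k m)"
    by (simp add: Curv_low_def sum_distrib_left mult_ac)
  also have "\<dots> = (\<Sum>m\<in>UNIV. (G z ** N z) $ m $ s * Curv G z i j k m)"
    by (subst sum.swap) (simp add: matrix_matrix_mult_def sum_distrib_right)
  also have "\<dots> = Curv G z i j k s"
    using z by (simp add: G_N mat_def if_distrib[of "\<lambda>x. x * _"] cong: if_cong)
  also have "\<dots> = - mwirt \<i> j (\<lambda>w. mwirt (- \<i>) i G w ** N w) z $ k $ s"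
    by (simp add: Curv_def Gam_eq N_def mwirt_nth dzbar_eq_wirt)
  also have "mwirt \<i> j (\<lambda>w. mwirt (- \<i>) i G w ** N w) z
      = mwirt \<i> j (mwirt (- \<i>) i G) z ** N z + mwirt (- \<i>) i G z ** mwirt \<i> j N z"
    using z by (intro mwirt_mult diff_DG diff_N)
  also have "mwirt \<i> j (mwirt (- \<i>) i G) z = mwirt (- \<i>) i (mwirt \<i> j G) z"
    by (simp add: vec_eq_iff mwirt_nth wirt_commute[OF open_S z C2_G, of \<i>])
  finally show ?thesis
    using z by (simp add: mwirt_N dG_def matrix_expand matrix_mul_assoc)
qed

lemma Q_raised:
  assumes z: "z \<in> S"
  shows "(\<Sum>j\<in>UNIV. \<Sum>l\<in>UNIV. N z $ j $ p * N z $ l $ s * Qten G z i j k l) = Qhat z i p k s"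
proof -
  have curv: "(\<Sum>j\<in>UNIV. \<Sum>l\<in>UNIV. N z $ j $ p * N z $ l $ s * Curv_low G z i j k l) = (dG z i ** dbarG z p - ddG z i p) $ k $ s"
  proof -
    have "(\<Sum>j\<in>UNIV. \<Sum>l\<in>UNIV. N z $ j $ p * N z $ l $ s * Curv_low G z i j k l)
        = (\<Sum>j\<in>UNIV. N z $ j $ p * (\<Sum>l\<in>UNIV. N z $ l $ s * Curv_low G z i j k l))"
      by (simp add: sum_distrib_left mult_ac)
    also have "\<dots> = contract (N z) (\<lambda>j. dG z i ** (mwirt \<i> j G z ** N z) - mwirt (- \<i>) i (mwirt \<i> j G) z ** N z) p $ k $ s"
      unfolding Curv_raised[OF z] by (simp add: contract_def)
    finally show ?thesis
      by (simp add: contract_diff contract_mult_left dbarG_def ddG_def)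
  qed
  \<comment> \<open>The matrix here is indexed by \<open>k\<close>. Reading it with \<open>a\<close>
    as the derivative index exchanges \<open>dG\<close> with \<open>dG'\<close>, which reverses the
    sign relative to \<open>torsion_N\<close>.\<close>
  have t1: "(\<Sum>j\<in>UNIV. N z $ j $ p * Tor_low G z k a j) = (dG' z a - dG z a) $ k $ p" for a
  proof -
    have "(\<Sum>j\<in>UNIV. N z $ j $ p * Tor_low G z k a j) = (torsion z k ** N z) $ a $ p"
      by (simp add: matrix_matrix_mult_def torsion_def mult.commute)
    then show ?thesis
      by (simp add: torsion_N[OF z] dG'_def)
  qed
  \<comment> \<open>The inverse metric that contracts the two torsions is attached to the conjugated
    factor, so the torsion term becomes a single sum over \<open>a\<close>.\<close>
  have t2: "(\<Sum>l\<in>UNIV. \<Sum>b\<in>UNIV. N z $ l $ s * N z $ b $ a * cnj (Tor_low G z l b i)) = (dbarG' z a - dbarG z a) $ i $ s" for a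
  proof -
    have "(\<Sum>l\<in>UNIV. \<Sum>b\<in>UNIV. N z $ l $ s * N z $ b $ a * cnj (Tor_low G z l b i))
      = (\<Sum>l\<in>UNIV. \<Sum>b\<in>UNIV. N z $ l $ s * N z $ b $ a * mwirt \<i> l G z $ i $ b)
      - (\<Sum>l\<in>UNIV. \<Sum>b\<in>UNIV. N z $ l $ s * N z $ b $ a * mwirt \<i> b G z $ i $ l)"
      by (simp add: Tor_low_eq[OF z] mwirt_nth cnj_dz[OF z] right_diff_distrib sum_subtractf)
    also have "(\<Sum>l\<in>UNIV. \<Sum>b\<in>UNIV. N z $ l $ s * N z $ b $ a * mwirt \<i> l G z $ i $ b) = dbarG' z a $ i $ s"
      by (simp add: dbarG'_def dbarG_def contract_def matrix_matrix_mult_def sum_distrib_left mult_ac)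
    also have "(\<Sum>l\<in>UNIV. \<Sum>b\<in>UNIV. N z $ l $ s * N z $ b $ a * mwirt \<i> b G z $ i $ l) = dbarG z a $ i $ s"
      by (subst sum.swap) (simp add: dbarG_def contract_def matrix_matrix_mult_def sum_distrib_left mult_ac)
    finally show ?thesis by simp
  qed
  have tor: "(\<Sum>j\<in>UNIV. \<Sum>l\<in>UNIV. N z $ j $ p * N z $ l $ s *
        (\<Sum>a\<in>UNIV. \<Sum>b\<in>UNIV. ginv G z a b * Tor_low G z k a j * cnj (Tor_low G z l b i)))
      = (\<Sum>a\<in>UNIV. (dG' z a - dG z a) $ k $ p * (dbarG' z a - dbarG z a) $ i $ s)" (is "?L = ?R")
  proof -
    have "?R = (\<Sum>a\<in>UNIV. \<Sum>j\<in>UNIV. \<Sum>l\<in>UNIV. \<Sum>b\<in>UNIV.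
        N z $ j $ p * Tor_low G z k a j * (N z $ l $ s * N z $ b $ a * cnj (Tor_low G z l b i)))"
      unfolding t1[symmetric] t2[symmetric] by (simp add: sum_product) (simp add: sum_distrib_left)
    also have "\<dots> = ?L"
      unfolding sum_distrib_left unfolding sum.cartesian_product
      by (rule sum.reindex_bij_witness[of _ "\<lambda>(j,l,a,b). (a,j,l,b)" "\<lambda>(a,j,l,b). (j,l,a,b)"])
        (auto simp: ginv_def N_def mult_ac)
    finally show ?thesis by simp
  qed
  show ?thesis
    unfolding Qten_def right_diff_distrib sum_subtractf curv tor Qhat_def by simp
qed

lemma Q_term:
  assumes z: "z \<in> S"
  shows "(\<Sum>i\<in>UNIV. \<Sum>j\<in>UNIV. \<Sum>k\<in>UNIV. \<Sum>l\<in>UNIV. Qten G z i j k l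
      * (ginv G z i j * raise11 G (square_form G R) z k l - raise11 G R z i j * raise11 G R z k l))
    = (\<Sum>i\<in>UNIV. \<Sum>j\<in>UNIV. \<Sum>k\<in>UNIV. \<Sum>l\<in>UNIV.
        Qhat z i j k l * (mat 1 $ j $ i * (P z ** P z) $ l $ k - P z $ j $ i * P z $ l $ k))"
proof -
  have g: "ginv G z i j = (N z ** mat 1) $ j $ i" for i j
    by (simp add: ginv_def N_def)
  have r: "raise11 G R z i j = (N z ** P z) $ j $ i" for i j
    by (simp add: raise11_eq N_def P_def)
  have q: "raise11 G (square_form G R) z i j = (N z ** (P z ** P z)) $ j $ i" for i j
    by (simp add: raise11_eq square_form_eq N_def P_def matrix_mul_assoc)
  show ?thesis
    unfolding g r q right_diff_distrib sum_subtractf sum_contract_raised Q_raised[OF z] ..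
qed

lemma bochner_formula:
  assumes z: "z \<in> S"
  shows "(\<Sum>i\<in>UNIV. \<Sum>j\<in>UNIV. ginv G z i j * dz i (dzbar j (norm2_form G R)) z)
    = 2 * norm2_nabla_plus G R z
      + 2 * (\<Sum>i\<in>UNIV. \<Sum>j\<in>UNIV. \<Sum>k\<in>UNIV. \<Sum>l\<in>UNIV. Qten G z i j k l
          * (ginv G z i j * raise11 G (square_form G R) z k l - raise11 G R z i j * raise11 G R z k l))"
proof -
  note dd = contract_def matrix_matrix_mult_def mwirt_nth
  \<comment> \<open>The derivative index and the column index are raised by the same matrix
    \<open>N z\<close>, so the symmetry given by closedness survives the raising.\<close>
  have dbarR: "dbarR z i $ k $ l = dbarR z l $ k $ i" for i k l
    unfolding dbarR_def dd
    by (simp add: sum_distrib_left dz_R_symmetric(2)[OF z, of _ k])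
      (subst sum.swap, simp add: mult_ac dz_R_symmetric(2)[OF z])
  have F1: "ddR z i j $ k $ l = ddR z k j $ i $ l" for i j k l
    by (simp add: ddR_def dd dz_dzbar_R_symmetric(1)[OF z, of i _ k])
  have F2: "ddR z i j $ k $ l = ddR z i l $ k $ j" for i j k l
    unfolding ddR_def dd
    by (simp add: sum_distrib_left) (subst sum.swap, simp add: mult_ac dz_dzbar_R_symmetric(2)[OF z])
  have trF: "trace (ddR z k m) = trace (dbarR z m ** dG z k) + trace (dR z k ** dbarG z m)
      + trace (P z ** ddG z k m) - trace (P z ** dG z k ** dbarG z m) - trace (P z ** dbarG z m ** dG z k)" for k m
  proof -
    have "trace (contract (N z) (\<lambda>q. mwirt (- \<i>) k (mwirt \<i> q P) z) m) = 0"
      by (simp add: trace_contract trace_mwirt_mwirt_P[OF z])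
    then show ?thesis
      unfolding dz_dzbar_P[OF z] by (simp add: matrix_expand algebra_simps)
  qed
  have "dR z i $ k $ l = dR z k $ i $ l" for i k l
    by (simp add: dR_def dd dz_R_symmetric(1)[OF z, of i k])
  from bochner_identity_algebraic[OF _ _ this dbarR F1 F2 trF V_def W_def Qhat_def]
  show ?thesis
    unfolding laplacian_norm2[OF z] norm2_nabla_plus_eq[OF z] Q_term[OF z]
    by (simp add: dG'_def dbarG'_def distrib_left)
qed

end

theorem theorem3p1:
  fixes X :: "'a topology"
    and A :: "('a, 'n::finite) chart set"
    and g \<rho> :: "('a, 'n) tensor11"
  assumes "compact_hermitian_manifold X A g"
    and "real_form11 A \<rho>"
    and "closed_form11 A \<rho>"
    and "\<exists>c. \<forall>C\<in>A. \<forall>p\<in>fst C. trace11 (g C) (\<rho> C) (snd C p) = c"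
  shows "\<forall>C\<in>A. \<forall>p\<in>fst C. let G = g C; r = \<rho> C; z = snd C p in
    (\<Sum>i\<in>UNIV. \<Sum>j\<in>UNIV. ginv G z i j * dz i (dzbar j (norm2_form G r)) z)
    = 2 * norm2_nabla_plus G r z
      + 2 * (\<Sum>i\<in>UNIV. \<Sum>j\<in>UNIV. \<Sum>k\<in>UNIV. \<Sum>l\<in>UNIV. Qten G z i j k l
          * (ginv G z i j * raise11 G (square_form G r) z k l - raise11 G r z i j * raise11 G r z k l))"
proof (intro ballI, unfold Let_def)
  fix C p assume C: "C \<in> A" and p: "p \<in> fst C"
  obtain c where c: "\<forall>C\<in>A. \<forall>p\<in>fst C. trace11 (g C) (\<rho> C) (snd C p) = c"
    using assms(4) by blast
  interpret hermitian_chart "snd C ` fst C" "g C" "\<rho> C" c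
  proof
    show "open (snd C ` fst C)"
      using assms(1) C by (simp add: compact_hermitian_manifold_def compact_complex_manifold_def holomorphic_atlas_def)
    show "Ck_on 2 (snd C ` fst C) (\<lambda>z. g C z $ a $ b)" for a b
      using assms(1) C
      by (simp add: compact_hermitian_manifold_def hermitian_metric_def smooth_tensor11_def smooth_on_def)
    show "Ck_on 2 (snd C ` fst C) (\<lambda>z. \<rho> C z $ a $ b)" for a b
      using assms(2) C by (simp add: real_form11_def smooth_tensor11_def smooth_on_def)
    show "hermitian_mat (g C z)" "pos_def_mat (g C z)" if "z \<in> snd C ` fst C" for z
      using assms(1) C that by (auto simp: compact_hermitian_manifold_def hermitian_metric_def)
    show "hermitian_mat (\<rho> C z)" if "z \<in> snd C ` fst C" for z
      using assms(2) C that by (auto simp: real_form11_def)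
    show "ext_deriv2 (form11 (\<rho> C)) z u v w = 0" if "z \<in> snd C ` fst C" for z u v w
      using assms(3) C that by (auto simp: closed_form11_def)
    show "trace11 (g C) (\<rho> C) z = c" if "z \<in> snd C ` fst C" for z
      using c C that by auto
  qed
  from bochner_formula[OF imageI[OF p]]
  show "(\<Sum>i\<in>UNIV. \<Sum>j\<in>UNIV. ginv (g C) (snd C p) i j * dz i (dzbar j (norm2_form (g C) (\<rho> C))) (snd C p))
    = 2 * norm2_nabla_plus (g C) (\<rho> C) (snd C p)
      + 2 * (\<Sum>i\<in>UNIV. \<Sum>j\<in>UNIV. \<Sum>k\<in>UNIV. \<Sum>l\<in>UNIV. Qten (g C) (snd C p) i j k l
          * (ginv (g C) (snd C p) i j * raise11 (g C) (square_form (g C) (\<rho> C)) (snd C p) k l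
            - raise11 (g C) (\<rho> C) (snd C p) i j * raise11 (g C) (\<rho> C) (snd C p) k l))" .
qed

end
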